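(* Let $d_j$ ($j\geqslant1$) be real numbers with $0<d^-<d_j<d^+$, let $p(z)=\sum_{n\geqslant0}p_nz^n=\exp\{\sum_{j\geqslant1}\frac{d_j}{j}z^j\}$, and let $f(z)=\sum_{n\geqslant0}a_nz^n$ be analytic for $|z|<1$. Then $$\lim_{n\to\infty}\frac1{p_n}\sum_{k=0}^n a_kp_{n-k}=A\in\mathbb C$$ holds if and only if both (1) $\lim_{x\uparrow1}f(x)=A$ and (2) $S(f;n):=\sum_{k=1}^n a_kkp_{n-k}=o(np_n)$ as $n\to\infty$. *)

theory Defs
  imports "HOL-Complex_Analysis.Complex_Analysis" "HOL-Library.Landau_Symbols"
begin

end

theory Submission
  imports Defs
begin

text \<open>
  Subtracting \<open>A\<close> from \<open>a 0\<close>, assume \<open>A = 0\<close>. Let \<open>b n\<close>, \<open>s n\<close>, \<open>g n\<close> be the coefficients of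
  \<open>f p\<close>, \<open>z f' p\<close> and \<open>f z p'\<close>, so that \<open>n b n = s n + g n\<close>. Since \<open>z p' = p D\<close> with
  \<open>D = \<Sum>j. d j z^j\<close>, \<open>g\<close> is the convolution of \<open>b\<close> with the bounded sequence \<open>d\<close>; moreover \<open>n p n\<close> and
  \<open>P n = \<Sum>k\<le>n. p k\<close> have the same order of magnitude. Hence \<open>b n = o(p n)\<close> gives \<open>s n = o(n p n)\<close>, and
  \<open>f \<rightarrow> 0\<close> by an Abelian argument.

  For the converse it suffices that \<open>\<Sum>m\<le>n. \<bar>b m\<bar> = o(P n)\<close>. From \<open>s n = o(n p n)\<close> one gets
  \<open>\<bar>f'(z) p(z)\<bar> = o(p(\<bar>z\<bar>) / (1 - \<bar>z\<bar>))\<close>. Comparing \<open>p\<close> with the powers \<open>(1 - z)^(-c)\<close> and \<open>(1 - z)^(-C)\<close>,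
  where \<open>c < d j < C\<close>, and integrating \<open>f'\<close> first from the real axis across a Stolz angle and then along a radius,
  this and \<open>f(x) \<rightarrow> 0\<close> give \<open>\<bar>f(z) p(z)\<bar> = o(p(\<bar>z\<bar>))\<close> uniformly on circles. By Parseval,
  \<open>\<Sum>m. \<bar>g m\<bar>^2 r^(2 m)\<close> is at most \<open>max \<bar>f p\<bar>^2 \<Sum>j. (d j)^2 r^(2 j)\<close>; with \<open>1 - r\<close> of order \<open>1 / n\<close> the
  Cauchy-Schwarz inequality yields \<open>\<Sum>m\<le>n. m \<bar>b m\<bar> = o(n P n)\<close>, and Abel summation removes the factor \<open>m\<close>.
\<close>

section \<open>Power series on the unit disc\<close>

text \<open>Coefficients and sum function are related by one predicate, so that identities between
  functions pass to coefficients through \<open>disc_series_unique\<close>.\<close>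

definition disc_series :: "(nat \<Rightarrow> complex) \<Rightarrow> (complex \<Rightarrow> complex) \<Rightarrow> bool" where
  "disc_series u h \<longleftrightarrow> (\<forall>z. norm z < 1 \<longrightarrow> (\<lambda>n. u n * z ^ n) sums h z)"

lemma disc_seriesD: "disc_series u h \<Longrightarrow> norm z < 1 \<Longrightarrow> (\<lambda>n. u n * z ^ n) sums h z"
  by (simp add: disc_series_def)

lemma disc_series_abs_summable:
  assumes "disc_series u h" "0 \<le> r" "r < 1"
  shows "summable (\<lambda>n. norm (u n) * r ^ n)"
proof -
  define x where "x = (r + 1) / 2"
  have x: "r < x" "x < 1" using assms by (auto simp: x_def)
  have "summable (\<lambda>n. u n * of_real x ^ n)"
    using disc_seriesD[OF assms(1), of "of_real x"] x assms sums_summable by auto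
  then have "summable (\<lambda>n. norm (u n * of_real r ^ n))"
    by (rule powser_insidea) (use x assms in auto)
  then show ?thesis using assms by (simp add: norm_mult norm_power)
qed

text \<open>The operator \<open>z * deriv h z\<close> is used in place of \<open>deriv h z\<close>
  because it multiplies the n-th coefficient by \<open>n\<close> without shifting the index.\<close>

lemma disc_series_deriv:
  assumes "disc_series u h" "norm z < 1"
  shows "(h has_field_derivative deriv h z) (at z)"
    and "(\<lambda>n. of_nat n * u n * z ^ n) sums (z * deriv h z)"
proof -
  have sm: "summable (\<lambda>n. u n * w ^ n)" if "norm w < 1" for w
    using disc_seriesD[OF assms(1) that] sums_summable by blast
  have "((\<lambda>z. \<Sum>n. u n * z^n) has_field_derivative (\<Sum>n. diffs u n * z^n)) (at z)"
    by (rule termdiffs_strong'[OF sm assms(2)])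
  moreover have "eventually (\<lambda>w. w \<in> ball 0 1) (nhds z)"
    using assms(2) by (intro eventually_nhds_in_open) auto
  then have ev: "eventually (\<lambda>w. (\<Sum>n. u n * w^n) = h w) (nhds z)"
    by eventually_elim (use disc_seriesD[OF assms(1)] in \<open>auto simp: sums_iff\<close>)
  ultimately have D: "(h has_field_derivative (\<Sum>n. diffs u n * z^n)) (at z)"
    using DERIV_cong_ev[OF refl ev refl] by blast
  then show D': "(h has_field_derivative deriv h z) (at z)"
    by (simp add: DERIV_imp_deriv)
  have "summable (\<lambda>n. diffs u n * z^n)"
    by (rule termdiff_converges[OF assms(2) sm])
  then have "(\<lambda>n. diffs u n * z^n) sums deriv h z"
    using DERIV_unique[OF D D'] by (simp add: sums_iff)
  then have "(\<lambda>n. z * (diffs u n * z^n)) sums (z * deriv h z)"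
    by (rule sums_mult)
  moreover have "z * (diffs u n * z^n) = of_nat (Suc n) * u (Suc n) * z ^ Suc n" for n
    by (simp only: diffs_def power_Suc mult_ac)
  ultimately have "(\<lambda>n. of_nat (Suc n) * u (Suc n) * z ^ Suc n) sums (z * deriv h z)"
    by simp
  then show "(\<lambda>n. of_nat n * u n * z ^ n) sums (z * deriv h z)"
    using sums_Suc_imp[of "\<lambda>n. of_nat n * u n * z ^ n"] by simp
qed

lemma disc_series_mult:
  assumes "disc_series u h" "disc_series v k"
  shows "disc_series (\<lambda>n. \<Sum>i\<le>n. u i * v (n - i)) (\<lambda>z. h z * k z)"
  unfolding disc_series_def
proof (intro allI impI)
  fix z :: complex assume z: "norm z < 1"
  have "summable (\<lambda>n. norm (u n * z ^ n))" "summable (\<lambda>n. norm (v n * z ^ n))"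
    using disc_series_abs_summable[OF assms(1), of "norm z"] disc_series_abs_summable[OF assms(2), of "norm z"] z
    by (simp_all add: norm_mult norm_power)
  from Cauchy_product_sums[OF this]
  have "(\<lambda>n. \<Sum>i\<le>n. u i * z ^ i * (v (n - i) * z ^ (n - i))) sums (h z * k z)"
    using disc_seriesD[OF assms(1) z] disc_seriesD[OF assms(2) z] by (simp add: sums_iff)
  moreover have "(\<Sum>i\<le>n. u i * z ^ i * (v (n - i) * z ^ (n - i))) = (\<Sum>i\<le>n. u i * v (n - i)) * z ^ n" for n
    unfolding sum_distrib_right
    by (intro sum.cong refl) (simp add: algebra_simps flip: power_add)
  ultimately show "(\<lambda>n. (\<Sum>i\<le>n. u i * v (n - i)) * z ^ n) sums (h z * k z)"
    by simp
qed

lemma disc_series_unique: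
  assumes "disc_series u h" "disc_series v h"
  shows "u = v"
proof -
  have e: "h has_fps_expansion Abs_fps w" if "disc_series w h" for w
  proof (rule has_fps_expansionI)
    have "eventually (\<lambda>z::complex. z \<in> ball 0 1) (nhds 0)"
      by (intro eventually_nhds_in_open) auto
    then show "\<forall>\<^sub>F z in nhds 0. (\<lambda>n. fps_nth (Abs_fps w) n * z ^ n) sums h z"
      by eventually_elim (use disc_seriesD[OF that] in auto)
  qed
  have "Abs_fps u = Abs_fps v"
    using e[OF assms(1)] e[OF assms(2)] fps_expansion_unique_complex by blast
  then show ?thesis by (metis fps_nth_Abs_fps ext)
qed

text \<open>Parseval's identity. The partial sums converge uniformly on the circle, so the integrals
  of \<open>S N * cnj (S N)\<close> converge too, and orthogonality reduces each of them to its
  diagonal terms.\<close>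

lemma disc_series_parseval:
  assumes "disc_series u h" "0 \<le> r" "r < 1"
  shows "(\<lambda>n. (norm (u n))\<^sup>2 * r ^ (2 * n)) sums
     (integral {0..2*pi} (\<lambda>t. (norm (h (of_real r * cis t)))\<^sup>2) / (2 * pi))"
    and "(\<lambda>t. (norm (h (of_real r * cis t)))\<^sup>2) integrable_on {0..2*pi}"
proof -
  define C where "C n = u n * of_real r ^ n" for n
  define S where "S N t = (\<Sum>n<N. C n * cis t ^ n)" for N t
  define H where "H t = h (of_real r * cis t)" for t
  have "uniform_limit {0..2*pi} (\<lambda>N t. \<Sum>n<N. C n * cis t ^ n) (\<lambda>t. \<Sum>n. C n * cis t ^ n) sequentially"
    by (rule Weierstrass_m_test[where M = "\<lambda>n. norm (u n) * r ^ n"])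
       (use disc_series_abs_summable[OF assms] assms(2) in \<open>auto simp: C_def norm_mult norm_power\<close>)
  moreover have "(\<Sum>n. C n * cis t ^ n) = H t" for t
    using disc_seriesD[OF assms(1), of "of_real r * cis t"] assms
    by (simp add: H_def C_def norm_mult sums_iff power_mult_distrib mult.assoc)
  ultimately have ul: "uniform_limit {0..2*pi} S H sequentially"
    unfolding S_def by simp
  have cont: "continuous_on {0..2*pi} (S N)" for N
    unfolding S_def cis_conv_exp by (intro continuous_intros)
  have contH: "continuous_on {0..2*pi} H"
    by (rule uniform_limit_theorem[OF _ ul]) (auto simp: cont)
  have ulc: "uniform_limit {0..2*pi} (\<lambda>N t. cnj (S N t)) (\<lambda>t. cnj (H t)) sequentially"
    by (rule bounded_linear.uniform_limit[OF bounded_linear_cnj ul])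
  have bd: "bounded (H ` {0..2*pi})" "bounded ((\<lambda>t. cnj (H t)) ` {0..2*pi})"
    by (intro compact_imp_bounded compact_continuous_image continuous_intros contH compact_Icc)+
  have ul2: "uniform_limit {0..2*pi} (\<lambda>N t. S N t * cnj (S N t)) (\<lambda>t. H t * cnj (H t)) sequentially"
    by (rule uniform_lim_mult[OF ul ulc bd])
  obtain I J where IJ: "\<And>N. ((\<lambda>t. S N t * cnj (S N t)) has_integral I N) {0..2*pi}"
    "((\<lambda>t. H t * cnj (H t)) has_integral J) {0..2*pi}" "I \<longlonglongrightarrow> J"
    by (rule uniform_limit_integral[OF ul2]) (auto intro!: continuous_intros cont)
  \<comment> \<open>Orthogonality of the characters: for \<open>n \<noteq> m\<close> the explicit
    antiderivative takes equal values at \<open>0\<close> and \<open>2 * pi\<close>, so the integral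
    vanishes.\<close>
  have orth: "((\<lambda>t. cis t ^ n * cnj (cis t ^ m)) has_integral of_real (if n = m then 2 * pi else 0)) {0..2*pi}" for n m
  proof (cases "n = m")
    case True
    have "((\<lambda>t::real. 1::complex) has_integral (2 * pi) *\<^sub>R 1) {0..2*pi}"
      using has_integral_const_real[of "1::complex" 0 "2*pi"] by (simp add: content_real)
    moreover have "cis t ^ m * cnj (cis t ^ m) = 1" for t
      by (simp only: complex_norm_square[symmetric] norm_power norm_cis) simp
    ultimately show ?thesis using True by (simp add: scaleR_conv_of_real)
  next
    case False
    define k where "k = real n - real m"
    have k: "k \<noteq> 0" using False by (simp add: k_def)
    have eq: "cis t ^ n * cnj (cis t ^ m) = exp (\<i> * of_real (k * t))" for t
    proof -
      have "cis t ^ n * cnj (cis t ^ m) = cis (real n * t + - (real m * t))"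
        by (simp only: Complex.DeMoivre cis_cnj cis_mult)
      also have "real n * t + - (real m * t) = k * t"
        by (simp add: k_def algebra_simps)
      finally show ?thesis by (simp only: cis_conv_exp)
    qed
    have "((\<lambda>t. exp (\<i> * of_real (k * t))) has_integral
        exp (\<i> * of_real (k * (2*pi))) / (\<i> * k) - exp (\<i> * of_real (k * 0)) / (\<i> * k)) {0..2*pi}"
      by (rule fundamental_theorem_of_calculus)
         (use k in \<open>auto intro!: derivative_eq_intros has_vector_derivative_real_field simp: field_simps\<close>)
    moreover have "exp (\<i> * of_real (k * (2*pi))) = 1"
    proof -
      have "\<i> * of_real (k * (2*pi)) = \<i> * (of_int (int n - int m) * (of_real pi * 2))"
        by (simp add: k_def)
      then show ?thesis by (simp only: exp_2pi_1_int)
    qed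
    ultimately show ?thesis using False unfolding eq by simp
  qed
  have Ieq: "I N = (\<Sum>n<N. of_real (2 * pi * (norm (C n))\<^sup>2))" for N
  proof -
    have h: "((\<lambda>t. \<Sum>n<N. \<Sum>m<N. (C n * cnj (C m)) * (cis t ^ n * cnj (cis t ^ m))) has_integral
        (\<Sum>n<N. \<Sum>m<N. (C n * cnj (C m)) * (if n = m then 2 * pi else 0))) {0..2*pi}"
      by (intro has_integral_sum finite_lessThan has_integral_mult_right orth)
    have e1: "(\<Sum>n<N. \<Sum>m<N. (C n * cnj (C m)) * (cis t ^ n * cnj (cis t ^ m))) = S N t * cnj (S N t)" for t
      by (simp add: S_def sum_product algebra_simps)
    have e2: "(\<Sum>n<N. \<Sum>m<N. (C n * cnj (C m)) * of_real (if n = m then 2 * pi else 0)) =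
        (\<Sum>n<N. of_real (2 * pi * (norm (C n))\<^sup>2))"
    proof (rule sum.cong[OF refl])
      fix n assume "n \<in> {..<N}"
      then have "(\<Sum>m<N. (C n * cnj (C m)) * of_real (if n = m then 2 * pi else 0)) = C n * cnj (C n) * (2 * pi)"
        by (subst sum.remove[of _ n]) (auto intro!: sum.neutral)
      then show "(\<Sum>m<N. (C n * cnj (C m)) * of_real (if n = m then 2 * pi else 0)) = of_real (2 * pi * (norm (C n))\<^sup>2)"
        by (simp only: of_real_mult complex_norm_square mult.commute)
    qed
    show ?thesis
      by (rule has_integral_unique[OF IJ(1) h[unfolded e1 e2]])
  qed
  have "((\<lambda>t. (norm (H t))\<^sup>2) has_integral Re J) {0..2*pi}"
    using has_integral_Re[OF IJ(2)] by (simp add: complex_mult_cnj cmod_power2)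
  then have J: "integral {0..2*pi} (\<lambda>t. (norm (h (of_real r * cis t)))\<^sup>2) = Re J"
    unfolding H_def by (rule integral_unique)
  have "(\<lambda>N. Re (I N) / (2 * pi)) \<longlonglongrightarrow> Re J / (2 * pi)"
    by (intro tendsto_intros IJ(3)) simp
  moreover have "Re (I N) / (2 * pi) = (\<Sum>n<N. (norm (u n))\<^sup>2 * r ^ (2 * n))" for N
  proof -
    have "(norm (C n))\<^sup>2 = (norm (u n))\<^sup>2 * r ^ (2 * n)" for n
      using assms(2) by (simp add: C_def norm_mult norm_power power_mult_distrib mult.commute flip: power_mult)
    then show ?thesis
      unfolding Ieq Re_sum by (simp add: sum_divide_distrib)
  qed
  ultimately show "(\<lambda>n. (norm (u n))\<^sup>2 * r ^ (2 * n)) sums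
     (integral {0..2*pi} (\<lambda>t. (norm (h (of_real r * cis t)))\<^sup>2) / (2 * pi))"
    unfolding sums_def J by simp
  show "(\<lambda>t. (norm (h (of_real r * cis t)))\<^sup>2) integrable_on {0..2*pi}"
    using contH unfolding H_def by (intro integrable_continuous_interval continuous_intros)
qed


text \<open>Parseval for the product and for \<open>k\<close>: on the circle
  \<open>norm (h z * k z)\<close> is at most \<open>M * norm (k z)\<close>. This turns a sup bound
  on one factor into a mean-square bound on the convolved coefficients.\<close>

lemma disc_series_mult_l2:
  assumes "disc_series u h" "disc_series v k" "0 \<le> r" "r < 1"
    and M: "\<And>z. norm z = r \<Longrightarrow> norm (h z) \<le> M"
  shows "(\<Sum>n\<le>N. (norm (\<Sum>i\<le>n. u i * v (n - i)))\<^sup>2 * r ^ (2 * n)) \<le> M\<^sup>2 * (\<Sum>n. (norm (v n))\<^sup>2 * r ^ (2 * n))"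
proof -
  note P = disc_series_parseval[OF disc_series_mult[OF assms(1,2)] assms(3,4)]
  note Q = disc_series_parseval[OF assms(2) assms(3,4)]
  have "(\<Sum>n\<le>N. (norm (\<Sum>i\<le>n. u i * v (n - i)))\<^sup>2 * r ^ (2 * n))
      \<le> (\<Sum>n. (norm (\<Sum>i\<le>n. u i * v (n - i)))\<^sup>2 * r ^ (2 * n))"
    using P(1) assms(3) by (intro sum_le_suminf) (auto simp: sums_iff)
  also have "\<dots> = integral {0..2*pi} (\<lambda>t. (norm (h (of_real r * cis t) * k (of_real r * cis t)))\<^sup>2) / (2 * pi)"
    using P(1) by (simp add: sums_iff)
  also have "\<dots> \<le> integral {0..2*pi} (\<lambda>t. M\<^sup>2 * (norm (k (of_real r * cis t)))\<^sup>2) / (2 * pi)"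
  proof (intro divide_right_mono integral_le)
    show "(\<lambda>t. M\<^sup>2 * (norm (k (of_real r * cis t)))\<^sup>2) integrable_on {0..2*pi}"
      using integrable_on_mult_right[OF Q(2)] by simp
    fix t :: real
    have "(norm (h (of_real r * cis t)))\<^sup>2 \<le> M\<^sup>2"
      using M[of "of_real r * cis t"] assms(3) by (intro power_mono) (auto simp: norm_mult)
    then show "(norm (h (of_real r * cis t) * k (of_real r * cis t)))\<^sup>2 \<le> M\<^sup>2 * (norm (k (of_real r * cis t)))\<^sup>2"
      by (simp add: norm_mult power_mult_distrib mult_right_mono)
  qed (use P(2) in auto)
  also have "\<dots> = M\<^sup>2 * (\<Sum>n. (norm (v n))\<^sup>2 * r ^ (2 * n))"
    using Q(1) by (simp add: sums_iff)
  finally show ?thesis .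
qed

section \<open>The weights\<close>

lemma disc_series_log: "disc_series (\<lambda>n. 1 / of_nat n) (\<lambda>z. - Ln (1 - z))"
  unfolding disc_series_def
proof (intro allI impI)
  fix z :: complex assume "norm z < 1"
  \<comment> \<open>The term with \<open>n = 0\<close> is \<open>1 / 0 = 0\<close>, which agrees
    with the absent constant term of the logarithm.\<close>
  then show "(\<lambda>n. 1 / of_nat n * z ^ n) sums - Ln (1 - z)"
    using sums_minus[OF Ln_series'[of "-z"]] by simp
qed

text \<open>Termwise, \<open>Re (\<omega> ^ j) \<le> 1\<close> is multiplied by
  \<open>e j * (r ^ j - u ^ j) \<ge> 0\<close>. Applied to logarithms, this yields both comparisons
  of \<open>G\<close> with powers of \<open>1 - z\<close>.\<close>

lemma disc_series_Re_diff_le: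
  assumes E: "disc_series (\<lambda>j. of_real (e j)) E" and e: "\<And>j. e j \<ge> 0"
    and ur: "0 \<le> u" "u \<le> r" "r < 1" and w: "norm \<omega> = 1"
  shows "Re (E (of_real r * \<omega>)) - Re (E (of_real u * \<omega>)) \<le> Re (E (of_real r)) - Re (E (of_real u))"
proof (rule sums_le)
  have R: "(\<lambda>j. e j * Re (z ^ j)) sums Re (E z)" if "norm z < 1" for z
    using sums_Re[OF disc_seriesD[OF E that]] by simp
  show "(\<lambda>j. e j * Re ((of_real r * \<omega>) ^ j) - e j * Re ((of_real u * \<omega>) ^ j)) sums
      (Re (E (of_real r * \<omega>)) - Re (E (of_real u * \<omega>)))"
    by (intro sums_diff R) (use ur w in \<open>auto simp: norm_mult\<close>)
  show "(\<lambda>j. e j * Re (of_real r ^ j) - e j * Re (of_real u ^ j)) sums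
      (Re (E (of_real r)) - Re (E (of_real u)))"
    by (intro sums_diff R) (use ur w in \<open>auto simp: norm_mult\<close>)
  fix j
  have "Re (\<omega> ^ j) \<le> 1"
    using complex_Re_le_cmod[of "\<omega> ^ j"] w by (simp add: norm_power)
  moreover have "u ^ j \<le> r ^ j"
    using ur by (intro power_mono)
  ultimately have "(r ^ j - u ^ j) * Re (\<omega> ^ j) \<le> r ^ j - u ^ j"
    by (simp add: mult_left_le)
  then have "e j * ((r ^ j - u ^ j) * Re (\<omega> ^ j)) \<le> e j * (r ^ j - u ^ j)"
    by (rule mult_left_mono) (rule e)
  then show "e j * Re ((of_real r * \<omega>) ^ j) - e j * Re ((of_real u * \<omega>) ^ j) \<le>
      e j * Re (of_real r ^ j) - e j * Re (of_real u ^ j)"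
    by (simp add: power_mult_distrib algebra_simps flip: of_real_power)
qed

lemma norm_one_minus_of_real: "x \<le> 1 \<Longrightarrow> norm (1 - complex_of_real x) = 1 - x"
  using norm_of_real[of "1 - x", where 'a = complex] by simp

lemma complex_polar:
  fixes z :: complex
  obtains \<omega> where "norm \<omega> = 1" "z = of_real (norm z) * \<omega>"
  using rcis_cmod_Arg[of z] norm_cis[of "Arg z"] unfolding rcis_def by metis

section \<open>The exponential weights: \<open>c\<close> and \<open>C\<close> stand for the lower
  and upper bounds of the \<open>d j\<close>\<close>

locale exp_weights =
  fixes d :: "nat \<Rightarrow> real" and c C :: real and p :: "nat \<Rightarrow> real"
  assumes c_pos: "0 < c"
    and d_bounds: "\<And>j. j \<ge> 1 \<Longrightarrow> c < d j \<and> d j < C"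
    and p_exp: "\<And>z::complex. norm z < 1 \<Longrightarrow>
           (\<lambda>n. of_real (p n) * z ^ n) sums
             exp (\<Sum>j. of_real (d (Suc j)) / of_nat (Suc j) * z ^ Suc j)"
begin

lemma C_pos: "0 < C"
  using c_pos d_bounds[of 1] by linarith

definition L :: "complex \<Rightarrow> complex" where
  "L z = (\<Sum>j. of_real (d (Suc j)) / of_nat (Suc j) * z ^ Suc j)"

text \<open>\<open>G\<close> is the function \<open>p(z)\<close> of the paper, whose name is taken by the coefficients.\<close>

definition G :: "complex \<Rightarrow> complex" where "G z = exp (L z)"

text \<open>The modulus makes the value real and positive for every \<open>r\<close>; on
  \<open>[0, 1)\<close> it agrees with \<open>G\<close> itself, see
  \<open>G_of_real\<close>.\<close>

definition q :: "real \<Rightarrow> real" where "q r = norm (G (of_real r))"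

definition P :: "nat \<Rightarrow> real" where "P n = (\<Sum>k\<le>n. p k)"

text \<open>The value \<open>d 0\<close> is unconstrained; setting it to 0 makes \<open>dz\<close>
  the coefficient sequence of \<open>z * deriv L z\<close>.\<close>

definition dz :: "nat \<Rightarrow> real" where "dz j = (if j = 0 then 0 else d j)"

lemma dz_bounds: "0 \<le> dz j" "dz j \<le> C"
  using d_bounds[of j] c_pos C_pos by (auto simp: dz_def)

lemma disc_series_L: "disc_series (\<lambda>j. of_real (dz j / real j)) L"
  unfolding disc_series_def
proof (intro allI impI)
  fix z :: complex assume z: "norm z < 1"
  have "summable (\<lambda>j. of_real (dz j / real j) * z ^ j)"
  proof (rule summable_comparison_test)
    show "\<exists>N. \<forall>n\<ge>N. norm (of_real (dz n / real n) * z ^ n) \<le> C * norm z ^ n"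
    proof (intro exI[of _ 1] allI impI)
      fix n :: nat assume n: "1 \<le> n"
      have "dz n / real n \<le> dz n / 1"
        using n dz_bounds[of n] by (intro divide_left_mono) auto
      then have "norm (complex_of_real (dz n / real n)) \<le> C"
        using dz_bounds[of n] n by (simp add: norm_divide abs_of_nonneg)
      then show "norm (of_real (dz n / real n) * z ^ n) \<le> C * norm z ^ n"
        by (simp only: norm_mult norm_power mult_right_mono norm_ge_zero zero_le_power)
    qed
    show "summable (\<lambda>n. C * norm z ^ n)"
      using z by (intro summable_mult summable_geometric) auto
  qed
  then have s: "(\<lambda>j. of_real (dz j / real j) * z ^ j) sums (\<Sum>j. of_real (dz j / real j) * z ^ j)"
    by (rule summable_sums)
  then have "(\<lambda>j. of_real (dz (Suc j) / real (Suc j)) * z ^ Suc j) sums (\<Sum>j. of_real (dz j / real j) * z ^ j)"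
    using sums_Suc_iff[of "\<lambda>j. of_real (dz j / real j) * z ^ j"] by (simp add: dz_def del: of_nat_Suc)
  then have "(\<Sum>j. of_real (dz j / real j) * z ^ j) = L z"
    unfolding L_def by (simp add: sums_iff dz_def del: of_nat_Suc)
  with s show "(\<lambda>j. of_real (dz j / real j) * z ^ j) sums L z" by simp
qed

section \<open>The recursion for the weights and its consequences\<close>

lemma disc_series_G: "disc_series (\<lambda>n. of_real (p n)) G"
  using p_exp by (simp add: disc_series_def G_def L_def)

lemma disc_series_D: "disc_series (\<lambda>n. of_real (dz n)) (\<lambda>z. z * deriv L z)"
  unfolding disc_series_def
proof (intro allI impI)
  fix z :: complex assume "norm z < 1"
  from disc_series_deriv(2)[OF disc_series_L this]
  show "(\<lambda>n. of_real (dz n) * z ^ n) sums (z * deriv L z)"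
    by (rule sums_cong[THEN iffD1, rotated]) (auto simp: dz_def)
qed

text \<open>Comparison of coefficients in \<open>z * deriv G z = z * deriv L z * G z\<close>, which
  holds because \<open>G\<close> is the exponential of \<open>L\<close>.\<close>

lemma p_conv: "real n * p n = (\<Sum>i\<le>n. dz i * p (n - i))"
proof -
  have "disc_series (\<lambda>n. of_nat n * of_real (p n)) (\<lambda>z. z * deriv L z * G z)"
    unfolding disc_series_def
  proof (intro allI impI)
    fix z :: complex assume z: "norm z < 1"
    have "(G has_field_derivative G z * deriv L z) (at z)"
      unfolding G_def by (auto intro!: derivative_eq_intros disc_series_deriv(1)[OF disc_series_L z])
    then have "z * deriv G z = z * deriv L z * G z"
      by (simp add: DERIV_imp_deriv)
    with disc_series_deriv(2)[OF disc_series_G z]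
    show "(\<lambda>n. of_nat n * of_real (p n) * z ^ n) sums (z * deriv L z * G z)" by simp
  qed
  from disc_series_unique[OF this disc_series_mult[OF disc_series_D disc_series_G]]
  have "of_nat n * complex_of_real (p n) = (\<Sum>i\<le>n. of_real (dz i) * of_real (p (n - i)))"
    by (simp add: fun_eq_iff)
  then have "complex_of_real (real n * p n) = of_real (\<Sum>i\<le>n. dz i * p (n - i))"
    by simp
  then show ?thesis by (simp only: of_real_eq_iff)
qed

lemma p_0: "p 0 = 1"
proof -
  have "complex_of_real (p 0) = G 0"
    using disc_seriesD[OF disc_series_G, of 0] powser_sums_zero sums_unique2 by fastforce
  moreover have "G 0 = 1" by (simp add: G_def L_def)
  ultimately show ?thesis by simp
qed

text \<open>Since \<open>dz 0 = 0\<close>, the term containing \<open>p (Suc n)\<close> drops out on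
  the right, which leaves a recursion suited to induction.\<close>

lemma p_Suc: "real (Suc n) * p (Suc n) = (\<Sum>k\<le>n. d (Suc n - k) * p k)"
proof -
  have "real (Suc n) * p (Suc n) = (\<Sum>k\<le>Suc n. dz (Suc n - k) * p k)"
    unfolding p_conv[of "Suc n"]
    by (rule sum.reindex_bij_witness[of _ "\<lambda>i. Suc n - i" "\<lambda>i. Suc n - i"]) auto
  also have "\<dots> = (\<Sum>k\<le>n. dz (Suc n - k) * p k)"
    by (simp add: dz_def)
  also have "\<dots> = (\<Sum>k\<le>n. d (Suc n - k) * p k)"
    by (intro sum.cong) (auto simp: dz_def)
  finally show ?thesis .
qed

lemma p_pos: "0 < p n"
proof (induction n rule: less_induct)
  case (less n)
  show ?case
  proof (cases n)
    case 0
    then show ?thesis by (simp add: p_0)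
  next
    case (Suc m)
    have "0 < (\<Sum>k\<le>m. d (Suc m - k) * p k)"
    proof (rule sum_pos)
      fix k assume "k \<in> {..m}"
      then have "1 \<le> Suc m - k" "k < n" using Suc by auto
      from d_bounds[OF this(1)] less[OF this(2)] show "0 < d (Suc m - k) * p k"
        using c_pos by (intro mult_pos_pos) auto
    qed auto
    then have "0 < real (Suc m) * p (Suc m)" by (simp only: p_Suc)
    then show ?thesis using Suc by (simp add: zero_less_mult_iff)
  qed
qed

lemma P_le_p_Suc: "c * P n \<le> real (Suc n) * p (Suc n)"
proof -
  have *: "c * p k \<le> d (Suc n - k) * p k" if "k \<in> {..n}" for k
  proof -
    have "1 \<le> Suc n - k" using that by auto
    from d_bounds[OF this] p_pos[of k] show ?thesis
      by (intro mult_right_mono) auto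
  qed
  show ?thesis
    unfolding p_Suc P_def sum_distrib_left using * by (intro sum_mono) blast
qed

lemma P_ge_1: "1 \<le> P n"
proof -
  have "p 0 \<le> P n"
    unfolding P_def by (rule member_le_sum) (auto intro: less_imp_le p_pos)
  then show ?thesis by (simp add: p_0)
qed

text \<open>As \<open>P n \<ge> 1\<close>, the recursion gives
  \<open>p (Suc n) \<ge> c / Suc n\<close>, so \<open>P\<close> dominates a multiple of the harmonic
  numbers.\<close>

lemma P_at_top: "filterlim P at_top at_top"
proof -
  have ge: "P n \<ge> c * harm n" for n
  proof (induction n)
    case 0
    then show ?case using P_ge_1[of 0] by (simp add: harm_def)
  next
    case (Suc n)
    have "c * 1 \<le> c * P n" using P_ge_1 c_pos by (intro mult_left_mono) auto
    also have "\<dots> \<le> real (Suc n) * p (Suc n)" by (rule P_le_p_Suc)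
    finally have "c / real (Suc n) \<le> p (Suc n)" by (simp add: field_simps del: of_nat_Suc)
    then show ?case using Suc by (simp add: P_def harm_Suc distrib_left divide_inverse)
  qed
  have "filterlim (\<lambda>n. c * harm n :: real) at_top at_top"
    by (rule filterlim_tendsto_pos_mult_at_top[OF tendsto_const c_pos harm_at_top])
  then show ?thesis
    by (rule filterlim_at_top_mono) (use ge in auto)
qed

section \<open>\<open>G\<close> on the real axis and the majorant \<open>q\<close>\<close>

lemma sums_q:
  assumes "0 \<le> r" "r < 1"
  shows "(\<lambda>n. p n * r ^ n) sums q r"
proof -
  have s: "(\<lambda>n. complex_of_real (p n * r ^ n)) sums G (of_real r)"
    using disc_seriesD[OF disc_series_G, of "of_real r"] assms by simp
  then have r: "(\<lambda>n. p n * r ^ n) sums Re (G (of_real r))"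
    using sums_Re[OF s] by simp
  have "G (of_real r) = of_real (Re (G (of_real r)))"
    using sums_unique2[OF s sums_of_real[OF r]] .
  moreover have "0 \<le> Re (G (of_real r))"
    using assms less_imp_le[OF p_pos] by (intro sums_le[OF _ sums_zero r]) auto
  ultimately have "q r = Re (G (of_real r))"
    unfolding q_def by (metis abs_of_nonneg norm_of_real)
  with r show ?thesis by simp
qed

lemma G_of_real:
  assumes "0 \<le> r" "r < 1"
  shows "G (of_real r) = of_real (q r)"
proof (rule sums_unique2)
  show "(\<lambda>n. of_real (p n) * of_real r ^ n) sums G (of_real r)"
    using disc_seriesD[OF disc_series_G, of "of_real r"] assms by simp
  show "(\<lambda>n. complex_of_real (p n) * of_real r ^ n) sums of_real (q r)"
    using sums_of_real[OF sums_q[OF assms], where 'a = complex] by simp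
qed

lemma q_ge: 
  assumes "0 \<le> r" "r < 1"
  shows "(\<Sum>k\<le>n. p k * r ^ k) \<le> q r"
proof -
  have "(\<Sum>k\<le>n. p k * r ^ k) \<le> (\<Sum>k. p k * r ^ k)"
    using sums_q[OF assms] assms less_imp_le[OF p_pos] by (intro sum_le_suminf) (auto simp: sums_iff)
  then show ?thesis using sums_q[OF assms] by (simp add: sums_iff)
qed

lemma q_ge_1: "0 \<le> r \<Longrightarrow> r < 1 \<Longrightarrow> 1 \<le> q r"
  using q_ge[of r 0] by (simp add: p_0)

lemma q_pos: "0 < q r"
  by (simp add: q_def G_def)

lemma norm_G_pos: "0 < norm (G z)"
  by (simp add: G_def)

lemma norm_G_le_q: 
  assumes "norm z < 1"
  shows "norm (G z) \<le> q (norm z)"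
proof (rule norm_sums_le[OF disc_seriesD[OF disc_series_G assms] sums_q])
  show "norm (complex_of_real (p n) * z ^ n) \<le> p n * norm z ^ n" for n
    using p_pos[of n] by (simp add: norm_mult norm_power)
qed (use assms in auto)

text \<open>A partial sum of the series of \<open>q\<close> tends to \<open>P n\<close> as
  \<open>r\<close> tends to 1, and \<open>P\<close> is unbounded.\<close>

lemma q_at_top: "filterlim q at_top (at_left 1)"
  unfolding filterlim_at_top
proof
  fix Z :: real
  have "eventually (\<lambda>n. Z < P n) sequentially"
    using P_at_top by (simp add: filterlim_at_top_dense)
  then obtain n where n: "P n > Z"
    by (auto simp: eventually_sequentially)
  have "((\<lambda>r. \<Sum>k\<le>n. p k * r ^ k) \<longlongrightarrow> (\<Sum>k\<le>n. p k * 1 ^ k)) (at_left 1)"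
    by (intro tendsto_intros)
  then have "eventually (\<lambda>r. Z < (\<Sum>k\<le>n. p k * r ^ k)) (at_left 1)"
    using n by (intro order_tendstoD) (auto simp: P_def)
  moreover have "eventually (\<lambda>r::real. r \<in> {0<..<1}) (at_left 1)"
    by (rule eventually_at_left_real) simp
  ultimately show "eventually (\<lambda>r. Z \<le> q r) (at_left 1)"
  proof eventually_elim
    case (elim r)
    then show ?case using q_ge[of r n] by simp
  qed
qed

text \<open>The series is \<open>r * q'(r)\<close>. Replacing each \<open>dz i\<close> with
  \<open>i \<ge> 1\<close> by \<open>C\<close> in \<open>p_conv\<close> turns the convolution into
  the coefficients of \<open>G z * C z / (1 - z)\<close>.\<close>

lemma sums_qD:
  assumes "0 \<le> r" "r < 1"
  shows "summable (\<lambda>n. real n * p n * r ^ n)"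
    and "(\<Sum>n. real n * p n * r ^ n) \<le> C * q r * (r / (1 - r))"
proof -
  have D: "(\<lambda>n. C * r ^ Suc n) sums (C * (r / (1 - r)))"
    using sums_mult[OF sums_mult[OF geometric_sums[of r], of r], of C] assms by simp
  have "disc_series (\<lambda>n. of_real (C * (if n = 0 then 0 else 1))) (\<lambda>z. of_real C * (z * (1 / (1 - z))))"
    unfolding disc_series_def
  proof (intro allI impI)
    fix z :: complex assume "norm z < 1"
    then have "(\<lambda>n. of_real C * (z * z ^ n)) sums (of_real C * (z * (1 / (1 - z))))"
      by (intro sums_mult geometric_sums)
    then show "(\<lambda>n. of_real (C * (if n = 0 then 0 else 1)) * z ^ n) sums (of_real C * (z * (1 / (1 - z))))"
      using sums_Suc[of "\<lambda>n. of_real (C * (if n = 0 then 0 else 1)) * z ^ n"] by simp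
  qed
  from disc_seriesD[OF disc_series_mult[OF this disc_series_G], of "of_real r"]
  have s: "(\<lambda>n. complex_of_real ((\<Sum>i\<le>n. C * (if i = 0 then 0 else 1) * p (n - i)) * r ^ n)) sums
      of_real (C * q r * (r / (1 - r)))"
    using assms by (simp add: G_of_real mult_ac)
  then have s: "(\<lambda>n. (\<Sum>i\<le>n. C * (if i = 0 then 0 else 1) * p (n - i)) * r ^ n) sums (C * q r * (r / (1 - r)))"
    by (simp only: sums_of_real_iff)
  have le: "real n * p n * r ^ n \<le> (\<Sum>i\<le>n. C * (if i = 0 then 0 else 1) * p (n - i)) * r ^ n" for n
  proof (rule mult_right_mono)
    show "real n * p n \<le> (\<Sum>i\<le>n. C * (if i = 0 then 0 else 1) * p (n - i))"
      unfolding p_conv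
    proof (intro sum_mono mult_right_mono less_imp_le[OF p_pos])
      show "dz i \<le> C * (if i = 0 then 0 else 1)" for i
        using dz_bounds(2)[of i] by (cases "i = 0") (auto simp: dz_def)
    qed
  qed (use assms in auto)
  show sm: "summable (\<lambda>n. real n * p n * r ^ n)"
    by (rule summable_comparison_test'[OF sums_summable[OF s], of 0])
       (use le assms less_imp_le[OF p_pos] in \<open>auto simp: abs_mult\<close>)
  show "(\<Sum>n. real n * p n * r ^ n) \<le> C * q r * (r / (1 - r))"
    using suminf_le[OF le sm sums_summable[OF s]] s by (simp add: sums_iff)
qed

text \<open>\<open>E\<close> is the logarithm of \<open>G z * (1 - z)^c\<close>, and its
  coefficients \<open>(d j - c) / j\<close> are nonnegative. The claim, freed of denominators, is
  that \<open>norm (G z) * norm (1 - z) powr c\<close> divided by its value at \<open>norm z\<close>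
  does not increase along a ray.\<close>

lemma norm_G_growth:
  assumes ur: "0 \<le> u" "u \<le> r" "r < 1" and w: "norm \<omega> = 1"
  shows "norm (G (of_real r * \<omega>)) * norm (1 - of_real r * \<omega>) powr c * (q u * (1 - u) powr c)
    \<le> q r * (1 - r) powr c * (norm (G (of_real u * \<omega>)) * norm (1 - of_real u * \<omega>) powr c)"
proof -
  define E where "E z = L z - of_real c * (- Ln (1 - z))" for z
  define e where "e j = dz j / real j - c * (1 / real j)" for j
  have "disc_series (\<lambda>j. of_real (e j)) E"
    unfolding disc_series_def
  proof (intro allI impI)
    fix z :: complex assume z: "norm z < 1"
    show "(\<lambda>j. of_real (e j) * z ^ j) sums E z"
      using sums_diff[OF disc_seriesD[OF disc_series_L z] sums_mult[OF disc_seriesD[OF disc_series_log z], of "of_real c"]]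
      by (simp add: e_def E_def algebra_simps)
  qed
  moreover have "e j \<ge> 0" for j
    using d_bounds[of j] by (cases "j = 0") (auto simp: e_def dz_def field_simps)
  ultimately have le: "Re (E (of_real r * \<omega>)) - Re (E (of_real u * \<omega>)) \<le> Re (E (of_real r)) - Re (E (of_real u))"
    using ur w by (rule disc_series_Re_diff_le)
  have ex: "exp (Re (E z)) = norm (G z) * norm (1 - z) powr c" if "norm z < 1" for z
  proof -
    have "1 - z \<noteq> 0" using that by auto
    then show ?thesis
      by (simp add: E_def G_def exp_add powr_def mult.commute)
  qed
  have "exp (Re (E (of_real r * \<omega>))) * exp (Re (E (of_real u))) \<le> exp (Re (E (of_real r))) * exp (Re (E (of_real u * \<omega>)))"
    using le by (simp flip: exp_add)
  moreover have "exp (Re (E (of_real x))) = q x * (1 - x) powr c" if "0 \<le> x" "x < 1" for x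
    using that by (subst ex) (auto simp: q_def norm_one_minus_of_real)
  ultimately show ?thesis
    using ur w by (simp add: ex norm_mult)
qed

lemma norm_G_upper:
  assumes "norm z < 1"
  shows "norm (G z) * norm (1 - z) powr c \<le> q (norm z) * (1 - norm z) powr c"
proof -
  obtain \<omega> where w: "norm \<omega> = 1" "z = of_real (norm z) * \<omega>"
    by (rule complex_polar)
  \<comment> \<open>With the starting radius \<open>u = 0\<close> all factors belonging to
    \<open>u\<close> become 1.\<close>
  have "G 0 = 1" "q 0 = 1" by (simp_all add: G_def L_def q_def)
  then show ?thesis
    using norm_G_growth[of 0 "norm z" \<omega>, folded w(2)] assms w(1) by simp
qed

text \<open>The mirror image of \<open>norm_G_upper\<close>: here \<open>E\<close> is the logarithm
  of \<open>(1 - z)^(-C) / G z\<close>, whose coefficients \<open>(C - d j) / j\<close> are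
  nonnegative.\<close>

lemma norm_G_lower:
  assumes z: "norm z < 1"
  shows "q (norm z) * (1 - norm z) powr C \<le> norm (G z) * norm (1 - z) powr C"
proof -
  define E where "E z = of_real C * (- Ln (1 - z)) - L z" for z
  define e where "e j = C * (1 / real j) - dz j / real j" for j
  obtain \<omega> where w: "norm \<omega> = 1" "z = of_real (norm z) * \<omega>"
    by (rule complex_polar)
  have "disc_series (\<lambda>j. of_real (e j)) E"
    unfolding disc_series_def
  proof (intro allI impI)
    fix z :: complex assume z: "norm z < 1"
    show "(\<lambda>j. of_real (e j) * z ^ j) sums E z"
      using sums_diff[OF sums_mult[OF disc_seriesD[OF disc_series_log z], of "of_real C"] disc_seriesD[OF disc_series_L z]]
      by (simp add: e_def E_def algebra_simps)
  qed
  moreover have "e j \<ge> 0" for j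
    using d_bounds[of j] by (cases "j = 0") (auto simp: e_def dz_def field_simps)
  ultimately have "Re (E (of_real (norm z) * \<omega>)) - Re (E (of_real 0 * \<omega>)) \<le> Re (E (of_real (norm z))) - Re (E (of_real 0))"
    by (rule disc_series_Re_diff_le) (use z w(1) in auto)
  then have le: "Re (E z) \<le> Re (E (of_real (norm z)))"
    unfolding w(2)[symmetric] by simp
  have ex: "exp (- Re (E z)) = norm (G z) * norm (1 - z) powr C" if "norm z < 1" for z
  proof -
    have "1 - z \<noteq> 0" using that by auto
    then show ?thesis
      by (simp add: E_def G_def exp_add powr_def mult.commute)
  qed
  have real: "exp (- Re (E (of_real x))) = q x * (1 - x) powr C" if "0 \<le> x" "x < 1" for x
    using that by (subst ex) (auto simp: q_def norm_one_minus_of_real)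
  have "q (norm z) * (1 - norm z) powr C = exp (- Re (E (of_real (norm z))))"
    using real z by simp
  also have "\<dots> \<le> exp (- Re (E z))" using le by simp
  finally show ?thesis unfolding ex[OF z] .
qed

end

section \<open>Smallness of the product on circles\<close>

text \<open>In the final theorem \<open>f\<close> is instantiated with the given function minus
  \<open>A\<close>, so all limits considered here are 0.\<close>

locale weighted_series = exp_weights +
  fixes a :: "nat \<Rightarrow> complex" and f :: "complex \<Rightarrow> complex"
  assumes disc_series_f: "disc_series a f"
begin

definition b :: "nat \<Rightarrow> complex" where
  "b n = (\<Sum>k\<le>n. a k * of_real (p (n - k)))"

definition s :: "nat \<Rightarrow> complex" where
  "s n = (\<Sum>k\<le>n. of_nat k * a k * of_real (p (n - k)))"

definition g :: "nat \<Rightarrow> complex" where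
  "g n = (\<Sum>i\<le>n. b i * of_real (dz (n - i)))"

lemma disc_series_b: "disc_series b (\<lambda>z. f z * G z)"
  using disc_series_mult[OF disc_series_f disc_series_G] unfolding b_def[abs_def] .

lemma disc_series_zf': "disc_series (\<lambda>n. of_nat n * a n) (\<lambda>z. z * deriv f z)"
  using disc_series_deriv(2)[OF disc_series_f] by (simp add: disc_series_def)

lemma disc_series_s: "disc_series s (\<lambda>z. z * deriv f z * G z)"
  using disc_series_mult[OF disc_series_zf' disc_series_G] unfolding s_def[abs_def] .

lemma disc_series_g: "disc_series g (\<lambda>z. f z * G z * (z * deriv L z))"
  using disc_series_mult[OF disc_series_b disc_series_D] unfolding g_def[abs_def] .

text \<open>Coefficients in the product rule for \<open>z * deriv (f * G)\<close>, with
  \<open>deriv G = G * deriv L\<close>.\<close>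

lemma n_b_eq: "of_nat n * b n = s n + g n"
proof -
  have "disc_series (\<lambda>n. of_nat n * b n - s n) (\<lambda>z. f z * G z * (z * deriv L z))"
    unfolding disc_series_def
  proof (intro allI impI)
    fix z :: complex assume z: "norm z < 1"
    have "(G has_field_derivative G z * deriv L z) (at z)"
      unfolding G_def by (auto intro!: derivative_eq_intros disc_series_deriv(1)[OF disc_series_L z])
    then have "((\<lambda>z. f z * G z) has_field_derivative deriv f z * G z + G z * deriv L z * f z) (at z)"
      by (intro DERIV_mult disc_series_deriv(1)[OF disc_series_f z])
    then have "deriv (\<lambda>z. f z * G z) z = deriv f z * G z + G z * deriv L z * f z"
      by (rule DERIV_imp_deriv)
    with sums_diff[OF disc_series_deriv(2)[OF disc_series_b z] disc_seriesD[OF disc_series_s z]]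
    show "(\<lambda>n. (of_nat n * b n - s n) * z ^ n) sums (f z * G z * (z * deriv L z))"
      by (simp add: algebra_simps)
  qed
  from fun_cong[OF disc_series_unique[OF this disc_series_g], of n] show ?thesis
    by (simp add: algebra_simps)
qed

lemma norm_g_le: "norm (g n) \<le> C * (\<Sum>i\<le>n. norm (b i))"
proof -
  have "norm (g n) \<le> (\<Sum>i\<le>n. norm (b i * of_real (dz (n - i))))"
    unfolding g_def by (rule norm_sum)
  also have "\<dots> \<le> (\<Sum>i\<le>n. norm (b i) * C)"
    by (intro sum_mono) (use dz_bounds in \<open>auto simp: norm_mult intro!: mult_left_mono\<close>)
  finally show ?thesis by (simp add: sum_distrib_left mult.commute)
qed

text \<open>The coefficients \<open>s n\<close> of \<open>z * deriv f z * G z\<close> are at most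
  \<open>\<epsilon> * n * p n\<close> beyond some \<open>N\<close>. \<open>sums_qD\<close> bounds
  that part by a multiple of \<open>q r / (1 - r)\<close>; the finitely many other terms are
  absorbed near the circle because \<open>q \<ge> 1\<close>.\<close>

lemma deriv_bound:
  assumes s: "(\<lambda>n. norm (s n)) \<in> o(\<lambda>n. real n * p n)" and \<eta>: "\<eta> > 0"
  obtains \<rho>0 where "1/2 \<le> \<rho>0" "\<rho>0 < 1"
    "\<And>v. \<rho>0 \<le> norm v \<Longrightarrow> norm v < 1 \<Longrightarrow> norm (deriv f v) * norm (G v) * (1 - norm v) \<le> \<eta> * q (norm v)"
proof -
  \<comment> \<open>Cancels the factor \<open>C\<close> of \<open>sums_qD\<close> and leaves half of
    \<open>\<eta>\<close> for the initial terms.\<close>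
  define \<epsilon> where "\<epsilon> = \<eta> / (2 * C)"
  have \<epsilon>: "\<epsilon> > 0" using \<eta> C_pos by (simp add: \<epsilon>_def)
  obtain N where N: "\<And>n. n \<ge> N \<Longrightarrow> norm (s n) \<le> \<epsilon> * (real n * p n)"
    using landau_o.smallD[OF s \<epsilon>] less_imp_le[OF p_pos]
    by (auto simp: eventually_sequentially abs_mult)
  define K where "K = (\<Sum>n<N. norm (s n)) + 1"
  have K: "K > 0" unfolding K_def by (intro add_nonneg_pos sum_nonneg) auto
  \<comment> \<open>The bound \<open>1/2\<close> allows cancelling the factor \<open>norm v\<close>
    at the cost of replacing \<open>K\<close> by \<open>2 * K\<close>; the other one ensures
    \<open>2 * K * (1 - r) \<le> \<eta> / 2\<close>.\<close>
  define \<rho>0 where "\<rho>0 = max (1/2) (1 - \<eta> / (4 * K))"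
  show ?thesis
  proof
    show "1/2 \<le> \<rho>0" by (simp add: \<rho>0_def)
    show "\<rho>0 < 1" using \<eta> K by (simp add: \<rho>0_def)
    fix v :: complex assume v: "\<rho>0 \<le> norm v" "norm v < 1"
    define r where "r = norm v"
    have r: "1/2 \<le> r" "r < 1" "1 - \<eta> / (4 * K) \<le> r" using v by (auto simp: r_def \<rho>0_def)
    note qD = sums_qD[of r]
    have le: "norm (s n * v ^ n) \<le> \<epsilon> * (real n * p n * r ^ n) + (if n \<in> {..<N} then norm (s n) else 0)" for n
    proof (cases "n < N")
      case True
      have "norm (s n * v ^ n) \<le> norm (s n) * 1"
        unfolding norm_mult norm_power by (intro mult_left_mono power_le_one) (use v in auto)
      moreover have "0 \<le> \<epsilon> * (real n * p n * r ^ n)"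
        using \<epsilon> less_imp_le[OF p_pos] r by simp
      ultimately show ?thesis using True by simp
    next
      case False
      then have "norm (s n) * r ^ n \<le> \<epsilon> * (real n * p n) * r ^ n"
        using N[of n] r by (intro mult_right_mono) auto
      then show ?thesis using False by (simp add: norm_mult norm_power r_def mult_ac)
    qed
    have "norm (v * deriv f v * G v) \<le> \<epsilon> * (\<Sum>n. real n * p n * r ^ n) + (\<Sum>n<N. norm (s n))"
    proof (rule norm_sums_le[OF disc_seriesD[OF disc_series_s v(2)] _ le])
      show "(\<lambda>n. \<epsilon> * (real n * p n * r ^ n) + (if n \<in> {..<N} then norm (s n) else 0)) sums
          (\<epsilon> * (\<Sum>n. real n * p n * r ^ n) + (\<Sum>n<N. norm (s n)))"
        by (intro sums_add sums_mult summable_sums qD sums_If_finite_set) (use r in auto)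
    qed
    also have "\<epsilon> * (\<Sum>n. real n * p n * r ^ n) \<le> \<epsilon> * (C * q r * (r / (1 - r)))"
      using qD r \<epsilon> by (intro mult_left_mono) auto
    also have "\<epsilon> * (C * q r * (r / (1 - r))) = r * (\<eta> / 2 * q r / (1 - r))"
      using C_pos by (simp add: \<epsilon>_def)
    also have "(\<Sum>n<N. norm (s n)) \<le> K" by (simp add: K_def)
    also have "K \<le> r * (2 * K)" using r K by simp
    finally have "r * (norm (deriv f v) * norm (G v)) \<le> r * (\<eta> / 2 * q r / (1 - r) + 2 * K)"
      by (simp add: norm_mult r_def algebra_simps)
    then have "norm (deriv f v) * norm (G v) \<le> \<eta> / 2 * q r / (1 - r) + 2 * K"
      using r by (subst (asm) mult_le_cancel_left_pos) auto
    then have "norm (deriv f v) * norm (G v) * (1 - r) \<le> (\<eta> / 2 * q r / (1 - r) + 2 * K) * (1 - r)"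
      using r by (intro mult_right_mono) auto
    also have "\<dots> = \<eta> / 2 * q r + 2 * K * (1 - r)"
      using r by (simp add: field_simps)
    also have "2 * K * (1 - r) \<le> \<eta> / 2 * 1"
      using r K by (simp add: field_simps)
    also have "\<eta> / 2 * 1 \<le> \<eta> / 2 * q r"
      using q_ge_1[of r] r \<eta> by (intro mult_left_mono) auto
    finally show "norm (deriv f v) * norm (G v) * (1 - norm v) \<le> \<eta> * q (norm v)"
      by (simp add: r_def)
  qed
qed

text \<open>\<open>deriv f\<close> is integrated along the radius. \<open>norm_G_growth\<close>
  transfers the quotient \<open>q / norm G\<close> from an intermediate point to the endpoint
  \<open>z\<close>, and \<open>far\<close> keeps \<open>norm (1 - v)\<close> below
  \<open>2 * norm (1 - z)\<close>. What remains is the integral of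
  \<open>(1 - u) powr (-c-1)\<close>.\<close>

lemma ray_bound:
  assumes D: "\<And>v. \<rho>0 \<le> norm v \<Longrightarrow> norm v < 1 \<Longrightarrow> norm (deriv f v) * norm (G v) * (1 - norm v) \<le> \<eta> * q (norm v)"
    and \<eta>: "\<eta> > 0" and \<rho>: "0 \<le> \<rho>" "\<rho>0 \<le> \<rho>" "\<rho> \<le> r" "r < 1" and w: "norm \<omega> = 1"
    and far: "1 - \<rho> \<le> norm (1 - of_real r * \<omega>)"
  shows "norm (f (of_real r * \<omega>) - f (of_real \<rho> * \<omega>)) * norm (G (of_real r * \<omega>)) \<le> \<eta> * (2 powr c / c) * q r"
proof (cases "\<rho> = r")
  case True
  then show ?thesis using \<eta> c_pos q_pos[of r] by simp
next
  case False
  define z where "z = of_real r * \<omega>"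
  \<comment> \<open>Everything in the bound for \<open>deriv f\<close> that is constant along the
    ray; its factor \<open>(1 - r) powr c\<close> later cancels the value of the primitive at
    \<open>r\<close>.\<close>
  define K where "K = \<eta> * 2 powr c * (q r / norm (G z)) * (1 - r) powr c"
  have Gz: "0 < norm (G z)" by (rule norm_G_pos)
  have K: "K \<ge> 0" using \<eta> Gz less_imp_le[OF q_pos[of r]] by (simp add: K_def)
  have "norm (f (of_real r * \<omega>) - f (of_real \<rho> * \<omega>)) \<le> K / c * (1 - r) powr (-c) - K / c * (1 - \<rho>) powr (-c)"
  proof (rule differentiable_bound_general)
    show "\<rho> < r" using False \<rho> by simp
    have fd: "((\<lambda>u. f (of_real u * \<omega>)) has_vector_derivative deriv f (of_real u * \<omega>) * \<omega>) (at u)"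
      if "0 \<le> u" "u < 1" for u
    proof -
      have "(f has_field_derivative deriv f (of_real u * \<omega>)) (at (of_real u * \<omega>))"
        by (rule disc_series_deriv(1)[OF disc_series_f]) (use that w in \<open>auto simp: norm_mult\<close>)
      then have "((\<lambda>x. f (x * \<omega>)) has_field_derivative deriv f (of_real u * \<omega>) * \<omega>) (at (of_real u))"
        by (intro DERIV_chain2[where g = "\<lambda>x. x * \<omega>"]) (auto intro!: derivative_eq_intros)
      then show ?thesis by (rule has_vector_derivative_real_field)
    qed
    show "continuous_on {\<rho>..r} (\<lambda>u. f (of_real u * \<omega>))"
      by (intro continuous_at_imp_continuous_on ballI has_vector_derivative_continuous[OF fd]) (use \<rho> in auto)
    show "continuous_on {\<rho>..r} (\<lambda>u. K / c * (1 - u) powr (-c))"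
      using \<rho> by (intro continuous_intros) auto
    show "((\<lambda>u. f (of_real u * \<omega>)) has_vector_derivative deriv f (of_real u * \<omega>) * \<omega>) (at u)"
      if "\<rho> < u" "u < r" for u using fd that \<rho> by auto
    show "((\<lambda>u. K / c * (1 - u) powr (-c)) has_vector_derivative K * (1 - u) powr (-c-1)) (at u)"
      if "\<rho> < u" "u < r" for u
      unfolding has_real_derivative_iff_has_vector_derivative[symmetric]
      using that \<rho> c_pos by (auto intro!: derivative_eq_intros simp: powr_diff)
    fix u assume u: "\<rho> < u" "u < r"
    define v where "v = of_real u * \<omega>"
    have nv: "norm v = u" using u \<rho> w by (simp add: v_def norm_mult)
    have Gv: "0 < norm (G v)" by (rule norm_G_pos)
    \<comment> \<open>Both points lie on one ray, so their distance is \<open>r - u\<close>, which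
      is at most \<open>1 - \<rho>\<close> and hence at most \<open>norm (1 - z)\<close>.\<close>
    have "z - v = of_real (r - u) * \<omega>" by (simp add: z_def v_def algebra_simps)
    then have "norm (z - v) = r - u" using w u by (simp only: norm_mult norm_of_real) simp
    moreover have "norm (1 - v) \<le> norm (1 - z) + norm (z - v)" by (metis norm_diff_triangle_ineq diff_add_cancel add_diff_eq norm_triangle_ineq)
    ultimately have 1: "norm (1 - v) \<le> 2 * norm (1 - z)"
      using far u \<rho> by (simp add: z_def)
    have "0 < 1 - \<rho>" using \<rho> u by linarith
    then have z1: "0 < norm (1 - z)" using far unfolding z_def by linarith
    have "norm (1 - v) powr c \<le> (2 * norm (1 - z)) powr c"
      using 1 c_pos by (intro powr_mono2) auto
    also have "\<dots> = 2 powr c * norm (1 - z) powr c"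
      by (simp add: powr_mult)
    finally have 2: "norm (1 - v) powr c \<le> 2 powr c * norm (1 - z) powr c" .
    have "norm (G z) * norm (1 - z) powr c * (q u * (1 - u) powr c)
        \<le> q r * (1 - r) powr c * (norm (G v) * norm (1 - v) powr c)"
      unfolding z_def v_def by (rule norm_G_growth) (use u \<rho> w in auto)
    also have "\<dots> \<le> q r * (1 - r) powr c * (norm (G v) * (2 powr c * norm (1 - z) powr c))"
      using 2 less_imp_le[OF q_pos[of r]] by (intro mult_left_mono) auto
    finally have "norm (1 - z) powr c * (norm (G z) * q u * (1 - u) powr c)
        \<le> norm (1 - z) powr c * (q r * (1 - r) powr c * norm (G v) * 2 powr c)"
      by (simp add: mult_ac)
    then have 3: "norm (G z) * q u * (1 - u) powr c \<le> q r * (1 - r) powr c * norm (G v) * 2 powr c"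
      using z1 by (subst (asm) mult_le_cancel_left_pos) auto
    have u1: "0 < (1 - u) powr c" "0 < 1 - u" using u \<rho> by auto
    have "norm (deriv f v) * (norm (G v) * (1 - u)) \<le> \<eta> * q u"
      using D[of v] nv u \<rho> by (simp add: mult.assoc)
    also have "\<dots> \<le> \<eta> * (q r * (1 - r) powr c * norm (G v) * 2 powr c / (norm (G z) * (1 - u) powr c))"
      using 3 Gz u1 \<eta> by (intro mult_left_mono) (auto simp: field_simps)
    also have "\<dots> = K / (1 - u) powr c * norm (G v)"
      using Gz by (simp add: K_def field_simps)
    also have "\<dots> = K * (1 - u) powr (-c-1) * (norm (G v) * (1 - u))"
      using u1 by (simp add: powr_diff powr_minus field_simps)
    finally have "norm (deriv f v) \<le> K * (1 - u) powr (-c-1)"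
      using u1 Gv by (subst (asm) mult_le_cancel_right_pos) auto
    then show "norm (deriv f (of_real u * \<omega>) * \<omega>) \<le> K * (1 - u) powr (-c-1)"
      using w by (simp add: norm_mult v_def)
  qed
  also have "\<dots> \<le> K / c * (1 - r) powr (-c)"
    using K c_pos by simp
  also have "\<dots> = \<eta> * (2 powr c / c) * q r / norm (G z)"
    using \<rho> c_pos by (simp add: K_def powr_minus field_simps)
  finally show ?thesis
    using Gz unfolding z_def[symmetric] by (simp only: pos_le_divide_eq)
qed

text \<open>The lens \<open>S\<close> is convex and contains both points. On it
  \<open>norm (1 - v) \<le> 2 * (1 - \<rho>) \<le> 2 * (1 - norm v)\<close>, a Stolz condition under
  which \<open>norm_G_lower\<close> gives \<open>q (norm v) \<le> 2 powr C * norm (G v)\<close>. So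
  \<open>deriv f\<close> is of order \<open>\<eta> / (1 - \<rho>)\<close>, while the distance is at
  most \<open>3 * (1 - \<rho>)\<close>.\<close>

lemma stolz_bound:
  assumes D: "\<And>v. \<rho>0 \<le> norm v \<Longrightarrow> norm v < 1 \<Longrightarrow> norm (deriv f v) * norm (G v) * (1 - norm v) \<le> \<eta> * q (norm v)"
    and \<eta>: "\<eta> > 0" and \<rho>: "0 \<le> \<rho>" "\<rho>0 \<le> 1 - 2 * (1 - \<rho>)" "\<rho> < 1"
    and w: "norm w \<le> \<rho>" "norm (1 - w) \<le> 2 * (1 - \<rho>)"
  shows "norm (f w - f (of_real \<rho>)) \<le> \<eta> * (3 * 2 powr C)"
proof -
  define S where "S = cball 0 \<rho> \<inter> cball (1::complex) (2 * (1 - \<rho>))"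
  have "norm (f w - f (of_real \<rho>)) \<le> \<eta> * 2 powr C / (1 - \<rho>) * norm (w - of_real \<rho>)"
  proof (rule field_differentiable_bound)
    show "convex S" unfolding S_def by (intro convex_Int convex_cball)
    show "w \<in> S" using w by (simp add: S_def dist_norm)
    show "of_real \<rho> \<in> S" using \<rho> by (simp add: S_def dist_norm norm_one_minus_of_real)
    fix v assume v: "v \<in> S"
    then have v1: "norm v \<le> \<rho>" "norm (1 - v) \<le> 2 * (1 - \<rho>)" by (auto simp: S_def dist_norm)
    have "1 - norm v \<le> norm (1 - v)" using norm_triangle_ineq2[of 1 v] by simp
    with v1 \<rho> have v2: "\<rho>0 \<le> norm v" "norm v < 1" by linarith+
    show "(f has_field_derivative deriv f v) (at v within S)"
      using disc_series_deriv(1)[OF disc_series_f v2(2)] by (rule has_field_derivative_at_within)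
    have Gv: "0 < norm (G v)" by (rule norm_G_pos)
    have p0: "0 < (1 - norm v) powr C" using v2 by simp
    have "q (norm v) * (1 - norm v) powr C \<le> norm (G v) * norm (1 - v) powr C"
      by (rule norm_G_lower[OF v2(2)])
    also have "\<dots> \<le> norm (G v) * (2 * (1 - norm v)) powr C"
      using v1 C_pos by (intro mult_left_mono powr_mono2) auto
    also have "\<dots> = norm (G v) * 2 powr C * (1 - norm v) powr C"
      using v2 by (subst powr_mult) auto
    finally have le: "q (norm v) \<le> norm (G v) * 2 powr C"
      using p0 by (subst (asm) mult_le_cancel_right_pos) auto
    have "norm (deriv f v) * (1 - norm v) * norm (G v) \<le> \<eta> * q (norm v)"
      using D[OF v2] by (simp add: mult_ac)
    also have "\<dots> \<le> \<eta> * 2 powr C * norm (G v)"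
      using mult_left_mono[OF le less_imp_le[OF \<eta>]] by (simp add: mult_ac)
    finally have "norm (deriv f v) * (1 - norm v) \<le> \<eta> * 2 powr C"
      using Gv by (subst (asm) mult_le_cancel_right_pos) auto
    moreover have "norm (deriv f v) * (1 - \<rho>) \<le> norm (deriv f v) * (1 - norm v)"
      using v1 by (intro mult_left_mono) auto
    ultimately show "norm (deriv f v) \<le> \<eta> * 2 powr C / (1 - \<rho>)"
      using \<rho> by (simp add: field_simps)
  qed
  also have "\<dots> \<le> \<eta> * 2 powr C / (1 - \<rho>) * (3 * (1 - \<rho>))"
  proof (rule mult_left_mono)
    have "norm (w - of_real \<rho>) \<le> norm (w - 1) + norm (1 - complex_of_real \<rho>)"
      by (metis diff_add_cancel add_diff_eq norm_triangle_ineq)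
    then show "norm (w - of_real \<rho>) \<le> 3 * (1 - \<rho>)"
      using w \<rho> by (simp add: norm_one_minus_of_real norm_minus_commute)
  qed (use \<eta> \<rho> in auto)
  also have "\<dots> = \<eta> * (3 * 2 powr C)"
    using \<rho> by (simp add: field_simps)
  finally show ?thesis .
qed

text \<open>Away from 1, the ray to \<open>z\<close> starts on a fixed circle where \<open>f\<close>
  is bounded, and \<open>norm (G z) / q r\<close> tends to 0 by \<open>norm_G_upper\<close>. Near 1,
  it starts at radius \<open>1 - norm (1 - z)\<close>, in a Stolz region from which
  \<open>stolz_bound\<close> leads to the real axis.\<close>

lemma product_small:
  assumes s: "(\<lambda>n. norm (s n)) \<in> o(\<lambda>n. real n * p n)"
    and lim: "((\<lambda>x::real. f (of_real x)) \<longlongrightarrow> 0) (at_left 1)" and \<epsilon>: "\<epsilon> > 0"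
  shows "eventually (\<lambda>r. \<forall>z. norm z = r \<longrightarrow> norm (f z * G z) \<le> \<epsilon> * q r) (at_left 1)"
proof -
  \<comment> \<open>The sum of the constants of \<open>ray_bound\<close> and
    \<open>stolz_bound\<close>; with \<open>\<eta> = \<epsilon> / (3 * B)\<close> the two errors
    together make \<open>\<epsilon> / 3\<close>.\<close>
  define B where "B = 2 powr c / c + 3 * 2 powr C"
  have B: "B > 0" using c_pos by (simp add: B_def add_pos_pos)
  define \<eta> where "\<eta> = \<epsilon> / (3 * B)"
  have \<eta>: "\<eta> > 0" using \<epsilon> B by (simp add: \<eta>_def)
  have \<eta>B: "\<eta> * (2 powr c / c) + \<eta> * (3 * 2 powr C) = \<epsilon> / 3"
    unfolding distrib_left[symmetric] B_def[symmetric] using B by (simp add: \<eta>_def)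
  have \<eta>c: "\<eta> * (2 powr c / c) \<le> \<epsilon> / 3" using \<eta>B \<eta> by (smt (verit) mult_pos_pos powr_gt_zero)
  obtain \<rho>0 where \<rho>0: "1/2 \<le> \<rho>0" "\<rho>0 < 1"
    and D: "\<And>v. \<rho>0 \<le> norm v \<Longrightarrow> norm v < 1 \<Longrightarrow> norm (deriv f v) * norm (G v) * (1 - norm v) \<le> \<eta> * q (norm v)"
    using deriv_bound[OF s \<eta>] by metis
  have "eventually (\<lambda>x::real. norm (f (of_real x)) < \<epsilon> / 3) (at_left 1)"
    using tendstoD[OF lim, of "\<epsilon> / 3"] \<epsilon> by simp
  then obtain x0 where x0: "x0 < 1" "\<And>x. x0 < x \<Longrightarrow> x < 1 \<Longrightarrow> norm (f (complex_of_real x)) < \<epsilon> / 3"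
    by (auto simp: eventually_at_left[of 0 "1::real", simplified])
  \<comment> \<open>The first entry keeps the lens of \<open>stolz_bound\<close> outside radius
    \<open>\<rho>0\<close>, the second keeps real points beyond \<open>1 - \<delta>\<close> where
    \<open>f\<close> is below \<open>\<epsilon> / 3\<close>.\<close>
  define \<delta> where "\<delta> = min ((1 - \<rho>0) / 2) (1 - x0)"
  have \<delta>: "0 < \<delta>" "\<rho>0 \<le> 1 - 2 * \<delta>" "x0 \<le> 1 - \<delta>"
    using \<rho>0 x0 by (auto simp: \<delta>_def min_def field_simps)
  have \<delta>1: "\<delta> \<le> 1/2" "\<rho>0 \<le> 1 - \<delta>" using \<delta> \<rho>0 by auto
  have "continuous_on (sphere 0 (1 - \<delta>)) f"
    by (intro continuous_at_imp_continuous_on ballI DERIV_isCont[OF disc_series_deriv(1)[OF disc_series_f]])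
       (use \<delta> in auto)
  then have "bounded (f ` sphere 0 (1 - \<delta>))"
    by (intro compact_imp_bounded compact_continuous_image) auto
  then obtain M where M: "\<And>v. norm v = 1 - \<delta> \<Longrightarrow> norm (f v) \<le> M"
    unfolding bounded_iff by (metis image_eqI mem_sphere_0)
  have "norm (complex_of_real (1 - \<delta>)) = 1 - \<delta>"
    unfolding norm_of_real using \<delta>1 by simp
  then have M0: "0 \<le> M" using M norm_ge_zero order_trans by blast
  have "((\<lambda>r. M * ((1 - r) / \<delta>) powr c) \<longlongrightarrow> M * ((1 - 1) / \<delta>) powr c) (at_left 1)"
  proof (intro tendsto_intros tendsto_powr')
    show "(1 - 1) / \<delta> \<noteq> 0 \<or> 0 < c \<and> (\<forall>\<^sub>F r in at_left 1. 0 \<le> (1 - r) / \<delta>)"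
      using c_pos \<delta> by (auto simp: eventually_at_filter)
  qed (use \<delta> in auto)
  then have "eventually (\<lambda>r. M * ((1 - r) / \<delta>) powr c < \<epsilon> / 3) (at_left 1)"
    using \<epsilon> by (intro order_tendstoD) auto
  moreover have "eventually (\<lambda>r::real. r \<in> {1 - \<delta><..<1}) (at_left 1)"
    using \<delta> by (intro eventually_at_left_real) simp
  ultimately show ?thesis
  proof eventually_elim
    case (elim r)
    show ?case
    proof (intro allI impI)
      fix z :: complex assume z: "norm z = r"
      have r: "1 - \<delta> < r" "r < 1" "0 \<le> r" using elim \<delta>1 by auto
      have qr: "0 < q r" by (rule q_pos)
      obtain \<omega> where w: "norm \<omega> = 1" "z = of_real r * \<omega>"
        using complex_polar[of z] z by metis
      have Gz: "norm (G z) \<le> q r" using norm_G_le_q[of z] z r by simp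
      have split: "norm (f z * G z) \<le> norm (f z - f v) * norm (G z) + norm (f v) * norm (G z)" for v
        using mult_right_mono[OF norm_triangle_sub[of "f z" "f v"], of "norm (G z)"]
        by (simp add: norm_mult algebra_simps)
      show "norm (f z * G z) \<le> \<epsilon> * q r"
      proof (cases "\<delta> \<le> norm (1 - z)")
        case True
        let ?v = "of_real (1 - \<delta>) * \<omega>"
        have "norm (f z - f ?v) * norm (G z) \<le> \<eta> * (2 powr c / c) * q r"
          unfolding w(2)
          by (rule ray_bound[OF D \<eta>]) (use \<delta>1 r w True in auto)
        also have "\<dots> \<le> \<epsilon> / 3 * q r" using \<eta>c qr by (intro mult_right_mono) auto
        finally have 1: "norm (f z - f ?v) * norm (G z) \<le> \<epsilon> / 3 * q r" .
        have "norm ?v = 1 - \<delta>" using w \<delta>1 by (simp only: norm_mult norm_of_real) simp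
        then have v: "norm (f ?v) \<le> M" by (rule M)
        have "norm (G z) * \<delta> powr c \<le> norm (G z) * norm (1 - z) powr c"
          using True \<delta> c_pos by (intro mult_left_mono powr_mono2) auto
        also have "\<dots> \<le> q r * (1 - r) powr c"
          using norm_G_upper[of z] z r by simp
        finally have "norm (G z) \<le> q r * ((1 - r) / \<delta>) powr c"
          using \<delta> r by (simp add: powr_divide field_simps)
        then have "norm (f ?v) * norm (G z) \<le> M * (q r * ((1 - r) / \<delta>) powr c)"
          using v M0 by (intro mult_mono) auto
        also have "\<dots> = (M * ((1 - r) / \<delta>) powr c) * q r" by simp
        also have "\<dots> \<le> \<epsilon> / 3 * q r"
          using elim qr by (intro mult_right_mono) auto
        finally have "norm (f z * G z) \<le> \<epsilon> / 3 * q r + \<epsilon> / 3 * q r"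
          using split[of ?v] 1 by linarith
        also have "\<dots> \<le> \<epsilon> * q r" using \<epsilon> qr by simp
        finally show ?thesis .
      next
        case False
        \<comment> \<open>The smallest radius allowed by the hypothesis \<open>far\<close> of
          \<open>ray_bound\<close>; it also places \<open>\<rho> * \<omega>\<close> within
          \<open>2 * (1 - \<rho>)\<close> of 1.\<close>
        define \<rho> where "\<rho> = 1 - norm (1 - z)"
        have "1 - r \<le> norm (1 - z)" using norm_triangle_ineq2[of 1 z] z by simp
        then have \<rho>: "\<rho> \<le> r" "1 - \<delta> < \<rho>" using False by (auto simp: \<rho>_def)
        let ?v = "of_real \<rho> * \<omega>"
        have 1: "norm (f z - f ?v) * norm (G z) \<le> \<eta> * (2 powr c / c) * q r"
          unfolding w(2)
          by (rule ray_bound[OF D \<eta>]) (use \<delta>1 r w \<rho> in \<open>auto simp: \<rho>_def\<close>)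
        have "z - ?v = of_real (r - \<rho>) * \<omega>" by (simp add: w(2) algebra_simps)
        then have "norm (z - ?v) = r - \<rho>" using w \<rho> by (simp only: norm_mult norm_of_real) simp
        moreover have "norm (1 - ?v) \<le> norm (1 - z) + norm (z - ?v)"
          by (metis diff_add_cancel add_diff_eq norm_triangle_ineq)
        ultimately have v: "norm (1 - ?v) \<le> 2 * (1 - \<rho>)"
          using r by (simp add: \<rho>_def)
        have "norm (f ?v - f (of_real \<rho>)) \<le> \<eta> * (3 * 2 powr C)"
        proof (rule stolz_bound[OF D \<eta> _ _ _ _ v])
          show "norm ?v \<le> \<rho>" using w \<rho> \<delta>1 by (simp add: norm_mult)
        qed (use \<rho> \<delta> \<delta>1 r in auto)
        moreover have "norm (f (of_real \<rho>)) < \<epsilon> / 3" using x0(2)[of \<rho>] \<rho> \<delta> r by simp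
        ultimately have "norm (f ?v) \<le> \<eta> * (3 * 2 powr C) + \<epsilon> / 3"
          using norm_triangle_sub[of "f ?v" "f (of_real \<rho>)"] by linarith
        then have "norm (f ?v) * norm (G z) \<le> (\<eta> * (3 * 2 powr C) + \<epsilon> / 3) * q r"
          using Gz by (intro mult_mono) (use \<eta> \<epsilon> in auto)
        with 1 split[of ?v] have "norm (f z * G z) \<le> (\<eta> * (2 powr c / c) + \<eta> * (3 * 2 powr C) + \<epsilon> / 3) * q r"
          unfolding distrib_right by linarith
        also have "\<dots> \<le> \<epsilon> * q r"
          unfolding \<eta>B using \<epsilon> qr by (intro mult_right_mono) auto
        finally show ?thesis .
      qed
    qed
  qed
qed

end

section \<open>Passage to the coefficients\<close>

context exp_weights
begin

text \<open>The recursion bounds \<open>P (n - 1)\<close> by \<open>n * p n / c\<close>, and the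
  last summand is \<open>p n\<close> itself. The factor \<open>Suc n\<close> lets the bound include
  \<open>n = 0\<close>.\<close>

lemma P_le: "P n \<le> (1 / c + 1) * (real (Suc n) * p n)"
proof (cases n)
  case 0
  then show ?thesis using c_pos by (simp add: P_def p_0)
next
  case (Suc m)
  have "P n = P m + p n" by (simp add: P_def Suc)
  moreover have "P m \<le> 1 / c * (real n * p n)"
    using P_le_p_Suc[of m] c_pos by (simp add: Suc field_simps del: of_nat_Suc)
  moreover have "1 / c * (real n * p n) \<le> 1 / c * (real (Suc n) * p n)"
    using c_pos p_pos[of n] by (intro mult_left_mono mult_right_mono) auto
  moreover have "p n \<le> 1 * (real (Suc n) * p n)" using p_pos[of n] by simp
  ultimately show ?thesis unfolding distrib_right by linarith
qed

lemma P_pos: "0 < P n"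
  using P_ge_1[of n] by linarith

lemma P_bigo: "P \<in> O(\<lambda>n. real n * p n)"
proof (rule bigoI)
  have "P n \<le> (1 / c + 1) * 2 * (real n * p n)" if "n \<ge> 1" for n
  proof -
    have "P n \<le> (1 / c + 1) * (real (Suc n) * p n)" by (rule P_le)
    also have "\<dots> \<le> (1 / c + 1) * ((2 * real n) * p n)"
      using that c_pos p_pos[of n] by (intro mult_left_mono mult_right_mono) auto
    finally show ?thesis by (simp add: mult_ac)
  qed
  then show "eventually (\<lambda>n. norm (P n) \<le> (1 / c + 1) * 2 * norm (real n * p n)) at_top"
    using P_pos p_pos by (intro eventually_at_top_linorderI[of 1]) (simp add: abs_mult abs_of_pos)
qed

text \<open>The radius is chosen to give \<open>r / (1 - r) \<le> n / (2 * C)\<close>, so that the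
  tail bound from \<open>sums_qD\<close> is at most half of \<open>q r\<close> and can be moved to
  the left.\<close>

lemma q_le_P:
  assumes n: "n \<ge> 1"
  shows "q (exp (- (2 * C / real n))) \<le> 2 * P n"
proof -
  define r where "r = exp (- (2 * C / real n))"
  have r: "0 \<le> r" "r < 1" using n C_pos by (auto simp: r_def)
  have "1 + 2 * C / real n \<le> exp (2 * C / real n)" by (rule exp_ge_add_one_self)
  then have "r * (1 + 2 * C / real n) \<le> 1"
    by (simp add: r_def exp_minus field_simps)
  then have rr: "r / (1 - r) \<le> real n / (2 * C)"
    using r n C_pos by (simp add: field_simps)
  have "real n * q r \<le> real n * P n + C * q r * (r / (1 - r))"
  proof -
    \<comment> \<open>The tail \<open>m > n\<close> of \<open>q r\<close> is at most \<open>\<Sum>m. m p m r^m / n\<close>.\<close>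
    have "(\<lambda>m. real n * (p m * r ^ m)) sums (real n * q r)"
      by (intro sums_mult sums_q r)
    moreover have "(\<lambda>m. (if m \<in> {..n} then real n * p m else 0) + real m * p m * r ^ m) sums
        ((\<Sum>m\<le>n. real n * p m) + (\<Sum>m. real m * p m * r ^ m))"
      by (intro sums_add sums_If_finite_set summable_sums sums_qD(1) r) auto
    moreover have "real n * (p m * r ^ m) \<le> (if m \<in> {..n} then real n * p m else 0) + real m * p m * r ^ m" for m
    proof (cases "m \<le> n")
      case True
      have "real n * (p m * r ^ m) \<le> real n * (p m * 1)"
        using r p_pos[of m] by (intro mult_left_mono power_le_one) auto
      moreover have "0 \<le> real m * p m * r ^ m" using r p_pos[of m] by simp
      ultimately show ?thesis using True by simp
    next
      case False
      have "real n * (p m * r ^ m) \<le> real m * (p m * r ^ m)"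
        using r p_pos[of m] False by (intro mult_right_mono) auto
      then show ?thesis using False by simp
    qed
    ultimately have "real n * q r \<le> (\<Sum>m\<le>n. real n * p m) + (\<Sum>m. real m * p m * r ^ m)"
      by (rule sums_le[rotated])
    then show ?thesis
      using sums_qD(2)[OF r] by (simp add: P_def sum_distrib_left)
  qed
  also have "C * q r * (r / (1 - r)) \<le> C * q r * (real n / (2 * C))"
    using rr C_pos q_pos[of r] by (intro mult_left_mono) auto
  also have "\<dots> = real n * (q r / 2)" using C_pos by simp
  finally have "real n * q r \<le> real n * (P n + q r / 2)" by (simp add: distrib_left)
  then have "q r \<le> P n + q r / 2" using n by simp
  then show ?thesis by (simp add: r_def)
qed

text \<open>Beyond some \<open>N\<close> the terms compare with \<open>p\<close>; the fixed initial
  sum is negligible since \<open>P\<close> tends to infinity.\<close>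

lemma sum_smallo_P:
  fixes x :: "nat \<Rightarrow> real"
  assumes "x \<in> o(p)"
  shows "(\<lambda>n. \<Sum>k\<le>n. \<bar>x k\<bar>) \<in> o(P)"
proof (rule landau_o.smallI)
  fix \<epsilon> :: real assume \<epsilon>: "\<epsilon> > 0"
  obtain N where N: "\<And>n. n \<ge> N \<Longrightarrow> \<bar>x n\<bar> \<le> \<epsilon> / 2 * p n"
    using landau_o.smallD[OF assms, of "\<epsilon> / 2"] \<epsilon> less_imp_le[OF p_pos]
    by (auto simp: eventually_sequentially)
  define K where "K = (\<Sum>k<N. \<bar>x k\<bar>)"
  have le: "(\<Sum>k\<le>n. \<bar>x k\<bar>) \<le> K + \<epsilon> / 2 * P n" for n
  proof -
    have "(\<Sum>k\<le>n. \<bar>x k\<bar>) \<le> (\<Sum>k\<le>n. (if k \<in> {..<N} then \<bar>x k\<bar> else 0) + \<epsilon> / 2 * p k)"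
    proof (rule sum_mono)
      show "\<bar>x k\<bar> \<le> (if k \<in> {..<N} then \<bar>x k\<bar> else 0) + \<epsilon> / 2 * p k" for k
        using N[of k] \<epsilon> p_pos[of k] by auto
    qed
    also have "\<dots> = (\<Sum>k\<in>{..n} \<inter> {..<N}. \<bar>x k\<bar>) + \<epsilon> / 2 * P n"
      by (simp add: sum.distrib sum.inter_restrict P_def sum_distrib_left)
    also have "(\<Sum>k\<in>{..n} \<inter> {..<N}. \<bar>x k\<bar>) \<le> K"
      unfolding K_def by (intro sum_mono2) auto
    finally show ?thesis by simp
  qed
  have "eventually (\<lambda>n. 2 * K / \<epsilon> \<le> P n) at_top"
    using P_at_top by (simp add: filterlim_at_top)
  then show "eventually (\<lambda>n. norm (\<Sum>k\<le>n. \<bar>x k\<bar>) \<le> \<epsilon> * norm (P n)) at_top"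
  proof eventually_elim
    case (elim n)
    then have "K \<le> \<epsilon> / 2 * P n" using \<epsilon> by (simp add: field_simps)
    with le[of n] have "(\<Sum>k\<le>n. \<bar>x k\<bar>) \<le> \<epsilon> * P n" by simp
    moreover have "0 \<le> (\<Sum>k\<le>n. \<bar>x k\<bar>)" by (intro sum_nonneg) auto
    ultimately show ?case using P_ge_1[of n] by simp
  qed
qed

end

section \<open>Both implications at the level of coefficients\<close>

context weighted_series
begin

text \<open>At radius \<open>R n\<close>, \<open>product_small\<close> and \<open>q_le_P\<close>
  bound \<open>f * G\<close> by \<open>2 * \<epsilon> * P n\<close>.
  \<open>disc_series_mult_l2\<close> then bounds the mean square of \<open>g\<close>, and
  Cauchy-Schwarz passes to the plain sum.\<close>

lemma sum_norm_g_smallo: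
  assumes s: "(\<lambda>n. norm (s n)) \<in> o(\<lambda>n. real n * p n)"
    and lim: "((\<lambda>x::real. f (of_real x)) \<longlongrightarrow> 0) (at_left 1)"
  shows "(\<lambda>n. \<Sum>m\<le>n. norm (g m)) \<in> o(\<lambda>n. real n * P n)"
proof (rule landau_o.smallI)
  fix \<epsilon>' :: real assume \<epsilon>': "\<epsilon>' > 0"
  \<comment> \<open>The constant produced by the Cauchy-Schwarz estimate at the end, after bounding
    \<open>Suc n\<close> by \<open>2 * n\<close>.\<close>
  define K where "K = sqrt (2 * C * exp (4 * C))"
  have K: "K > 0" using C_pos by (simp add: K_def)
  define \<epsilon> where "\<epsilon> = \<epsilon>' / K"
  have \<epsilon>: "\<epsilon> > 0" using \<epsilon>' K by (simp add: \<epsilon>_def)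
  define R where "R n = exp (- (2 * C / real n))" for n :: nat
  have "filterlim R (at_left 1) at_top"
    unfolding filterlim_at
  proof
    have "R \<longlonglongrightarrow> exp (- 0)"
      unfolding R_def by (intro tendsto_intros tendsto_divide_0[OF tendsto_const] filterlim_at_top_imp_at_infinity filterlim_real_sequentially)
    then show "R \<longlonglongrightarrow> 1" by simp
    show "\<forall>\<^sub>F n in sequentially. R n \<in> {..<1} \<and> R n \<noteq> 1"
      using C_pos by (intro eventually_at_top_linorderI[of 1]) (auto simp: R_def)
  qed
  from eventually_compose_filterlim[OF product_small[OF s lim \<epsilon>] this]
  have "eventually (\<lambda>n. \<forall>z. norm z = R n \<longrightarrow> norm (f z * G z) \<le> \<epsilon> * q (R n)) at_top" .
  moreover have "eventually (\<lambda>n::nat. n \<ge> 1) at_top" by (rule eventually_ge_at_top)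
  ultimately show "eventually (\<lambda>n. norm (\<Sum>m\<le>n. norm (g m)) \<le> \<epsilon>' * norm (real n * P n)) at_top"
  proof eventually_elim
    case (elim n)
    define r where "r = R n"
    have r: "0 < r" "r < 1" using elim(2) C_pos by (auto simp: r_def R_def)
    have P0: "0 < P n" using P_ge_1[of n] by linarith
    have M: "norm (f z * G z) \<le> 2 * \<epsilon> * P n" if "norm z = r" for z
    proof -
      have "norm (f z * G z) \<le> \<epsilon> * q r" using elim(1) that by (simp add: r_def)
      also have "\<dots> \<le> \<epsilon> * (2 * P n)"
        unfolding r_def R_def using q_le_P[OF elim(2)] \<epsilon> by (intro mult_left_mono) auto
      finally show ?thesis by simp
    qed
    have r2: "r\<^sup>2 = exp (- (4 * C / real n))"
      by (simp add: r_def R_def power2_eq_square flip: exp_add)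
    have r21: "r\<^sup>2 < 1" "0 \<le> r\<^sup>2" using r by (auto simp: abs_square_less_1)
    have "1 + 4 * C / real n \<le> exp (4 * C / real n)" by (rule exp_ge_add_one_self)
    then have "r\<^sup>2 * (1 + 4 * C / real n) \<le> 1"
      unfolding r2 by (simp add: exp_minus field_simps)
    then have rr: "r\<^sup>2 / (1 - r\<^sup>2) \<le> real n / (4 * C)"
      using r21 elim(2) C_pos by (simp add: field_simps)
    have dsum: "(\<Sum>j. (norm (complex_of_real (dz j)))\<^sup>2 * r ^ (2 * j)) \<le> C\<^sup>2 * (real n / (4 * C))"
    proof -
      have le: "(norm (complex_of_real (dz j)))\<^sup>2 * r ^ (2 * j) \<le> C\<^sup>2 * (if j = 0 then 0 else (r\<^sup>2) ^ j)" for j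
      proof (cases "j = 0")
        case True
        then show ?thesis by (simp add: dz_def)
      next
        case False
        have "(dz j)\<^sup>2 * (r\<^sup>2) ^ j \<le> C\<^sup>2 * (r\<^sup>2) ^ j"
          using dz_bounds[of j] by (intro mult_right_mono power_mono) auto
        then show ?thesis using False by (simp add: power_mult)
      qed
      have "(\<lambda>j. r\<^sup>2 * (r\<^sup>2) ^ j) sums (r\<^sup>2 * (1 / (1 - r\<^sup>2)))"
        using r21 by (intro sums_mult geometric_sums) auto
      then have "(\<lambda>j. if j = 0 then 0 else (r\<^sup>2) ^ j) sums (r\<^sup>2 / (1 - r\<^sup>2))"
        using sums_Suc[of "\<lambda>j. if j = 0 then 0 else (r\<^sup>2) ^ j"] by simp
      then have sC: "(\<lambda>j. C\<^sup>2 * (if j = 0 then 0 else (r\<^sup>2) ^ j)) sums (C\<^sup>2 * (r\<^sup>2 / (1 - r\<^sup>2)))"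
        by (rule sums_mult)
      have "(\<Sum>j. (norm (complex_of_real (dz j)))\<^sup>2 * r ^ (2 * j)) \<le> C\<^sup>2 * (r\<^sup>2 / (1 - r\<^sup>2))"
        using suminf_le[OF le sums_summable[OF disc_series_parseval(1)[OF disc_series_D]] sums_summable[OF sC]] sC r
        by (simp add: sums_iff)
      also have "\<dots> \<le> C\<^sup>2 * (real n / (4 * C))"
        by (intro mult_left_mono rr) auto
      finally show ?thesis .
    qed
    \<comment> \<open>For \<open>m \<le> n\<close> the weight \<open>r ^ (2 * m)\<close> is at least
      \<open>r ^ (2 * n) = exp (- (4 * C))\<close>, so removing it costs only a constant.\<close>
    have "(\<Sum>m\<le>n. (norm (g m))\<^sup>2) * exp (- (4 * C)) \<le> (\<Sum>m\<le>n. (norm (g m))\<^sup>2 * r ^ (2 * m))"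
      unfolding sum_distrib_right
    proof (intro sum_mono mult_left_mono)
      fix m assume "m \<in> {..n}"
      then have "r ^ (2 * n) \<le> r ^ (2 * m)" using r by (intro power_decreasing) auto
      moreover have "r ^ (2 * n) = exp (- (4 * C))"
        using elim(2) unfolding power_mult r2 by (simp flip: exp_of_nat_mult)
      ultimately show "exp (- (4 * C)) \<le> r ^ (2 * m)" by simp
    qed auto
    also have "\<dots> \<le> (2 * \<epsilon> * P n)\<^sup>2 * (\<Sum>j. (norm (complex_of_real (dz j)))\<^sup>2 * r ^ (2 * j))"
      unfolding g_def using r M by (intro disc_series_mult_l2[OF disc_series_b disc_series_D]) auto
    also have "\<dots> \<le> (2 * \<epsilon> * P n)\<^sup>2 * (C\<^sup>2 * (real n / (4 * C)))"
      by (intro mult_left_mono dsum) auto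
    also have "\<dots> = (\<epsilon> * P n)\<^sup>2 * C * real n"
      using C_pos by (simp add: power2_eq_square)
    finally have sq: "(\<Sum>m\<le>n. (norm (g m))\<^sup>2) \<le> (\<epsilon> * P n)\<^sup>2 * C * real n * exp (4 * C)"
      by (simp add: exp_minus field_simps)
    have "(\<Sum>m\<le>n. norm (g m) * 1)\<^sup>2 \<le> (\<Sum>m\<le>n. (norm (g m))\<^sup>2) * (\<Sum>m\<le>n. 1\<^sup>2)"
      by (rule Cauchy_Schwarz_ineq_sum)
    also have "\<dots> = (\<Sum>m\<le>n. (norm (g m))\<^sup>2) * real (Suc n)" by simp
    also have "\<dots> \<le> ((\<epsilon> * P n)\<^sup>2 * C * real n * exp (4 * C)) * (2 * real n)"
      using sq elim(2) by (intro mult_mono) (auto intro!: sum_nonneg mult_nonneg_nonneg less_imp_le[OF C_pos])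
    also have "\<dots> = (\<epsilon> * P n * real n)\<^sup>2 * (2 * C * exp (4 * C))"
      by (simp add: power2_eq_square mult_ac)
    also have "\<dots> = (\<epsilon> * P n * real n * K)\<^sup>2"
      unfolding power_mult_distrib K_def using C_pos by simp
    finally have "(\<Sum>m\<le>n. norm (g m) * 1)\<^sup>2 \<le> (\<epsilon> * P n * real n * K)\<^sup>2" .
    moreover have "\<epsilon> * P n * real n * K = \<epsilon>' * (real n * P n)"
      using K by (simp add: \<epsilon>_def)
    ultimately have "(\<Sum>m\<le>n. norm (g m))\<^sup>2 \<le> (\<epsilon>' * (real n * P n))\<^sup>2" by simp
    moreover have "0 \<le> \<epsilon>' * (real n * P n)" using \<epsilon>' P0 by simp
    ultimately have "(\<Sum>m\<le>n. norm (g m)) \<le> \<epsilon>' * (real n * P n)"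
      by (rule power2_le_imp_le)
    then show ?case using P0 by (simp add: sum_nonneg abs_mult)
  qed
qed

text \<open>Abel summation with \<open>1 / m - 1 / (m + 1) = 1 / (m * (m + 1))\<close>. The index 0
  contributes nothing to \<open>X\<close>, hence the separate \<open>norm (b 0)\<close>; the last
  sum has the value 0 there by division by zero.\<close>

lemma sum_norm_b_eq:
  defines "X \<equiv> \<lambda>n. \<Sum>m\<le>n. real m * norm (b m)"
  shows "(\<Sum>m\<le>n. norm (b m)) = norm (b 0) + X n / real (Suc n) + (\<Sum>m\<le>n. X m / (real m * real (Suc m)))"
proof (induction n)
  case 0
  then show ?case by (simp add: X_def)
next
  case (Suc n)
  have X: "X (Suc n) = X n + real (Suc n) * norm (b (Suc n))" by (simp add: X_def)
  have "X (Suc n) / real (Suc (Suc n)) + X (Suc n) / (real (Suc n) * real (Suc (Suc n))) = X (Suc n) / real (Suc n)"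
    by (simp add: field_simps del: of_nat_Suc) (simp add: field_simps)
  also have "\<dots> = X n / real (Suc n) + norm (b (Suc n))"
    unfolding X by (simp add: field_simps del: of_nat_Suc)
  finally show ?case using Suc by simp
qed

text \<open>The identity \<open>n_b_eq\<close> is used twice. Summed over the index it gives
  \<open>X \<in> o(n * P n)\<close>, whence \<open>Y \<in> o(P)\<close> by Abel summation. Then, for
  a single index, \<open>norm (g n) \<le> C * Y n\<close> is of order \<open>o(n * p n)\<close>,
  like \<open>s n\<close>.\<close>

lemma b_smallo_if:
  assumes s: "(\<lambda>n. norm (s n)) \<in> o(\<lambda>n. real n * p n)"
    and lim: "((\<lambda>x::real. f (of_real x)) \<longlongrightarrow> 0) (at_left 1)"
  shows "(\<lambda>n. norm (b n)) \<in> o(p)"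
proof -
  define X where "X n = (\<Sum>m\<le>n. real m * norm (b m))" for n
  define Y where "Y n = (\<Sum>m\<le>n. norm (b m))" for n
  have pn: "eventually (\<lambda>n. real n \<noteq> 0) at_top"
    by (intro eventually_at_top_linorderI[of 1]) auto
  have "(\<lambda>n. norm (s n) / real n) \<in> o(\<lambda>n. (real n * p n) / real n)"
    by (rule landau_o.small.divide_right[OF pn s])
  also have "(\<lambda>n. (real n * p n) / real n) \<in> \<Theta>(p)"
    by (rule bigthetaI_cong) (use pn in eventually_elim, simp)
  finally have "(\<lambda>n. \<Sum>k\<le>n. \<bar>norm (s k) / real k\<bar>) \<in> o(P)"
    by (rule sum_smallo_P)
  then have 1: "(\<lambda>n. real n * (\<Sum>k\<le>n. \<bar>norm (s k) / real k\<bar>)) \<in> o(\<lambda>n. real n * P n)"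
    by (rule landau_o.small.mult_left)
  have "(\<lambda>n. real n * (\<Sum>k\<le>n. \<bar>norm (s k) / real k\<bar>) + (\<Sum>m\<le>n. norm (g m))) \<in> o(\<lambda>n. real n * P n)"
    by (intro sum_in_smallo 1 sum_norm_g_smallo s lim)
  moreover have "X \<in> O(\<lambda>n. real n * (\<Sum>k\<le>n. \<bar>norm (s k) / real k\<bar>) + (\<Sum>m\<le>n. norm (g m)))"
  proof (rule bigoI[of _ 1], rule always_eventually, rule allI)
    fix n
    have "real m * norm (b m) \<le> real n * \<bar>norm (s m) / real m\<bar> + norm (g m)" if "m \<le> n" for m
    proof -
      have "real m * norm (b m) = norm (of_nat m * b m)" by (simp add: norm_mult)
      also have "\<dots> \<le> norm (s m) + norm (g m)" unfolding n_b_eq by (rule norm_triangle_ineq)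
      \<comment> \<open>This includes \<open>m = 0\<close>, where the quotient is 0 by convention
        and \<open>s 0 = 0\<close>.\<close>
      also have "norm (s m) = real m * \<bar>norm (s m) / real m\<bar>"
        by (cases "m = 0") (auto simp: s_def)
      also have "\<dots> \<le> real n * \<bar>norm (s m) / real m\<bar>"
        using that by (intro mult_right_mono) auto
      finally show ?thesis by simp
    qed
    then have "X n \<le> (\<Sum>m\<le>n. real n * \<bar>norm (s m) / real m\<bar> + norm (g m))"
      unfolding X_def by (intro sum_mono) auto
    then have "X n \<le> real n * (\<Sum>k\<le>n. \<bar>norm (s k) / real k\<bar>) + (\<Sum>m\<le>n. norm (g m))"
      by (simp only: sum.distrib sum_distrib_left)
    moreover have "0 \<le> X n" unfolding X_def by (intro sum_nonneg) auto
    ultimately show "norm (X n) \<le> 1 * norm (real n * (\<Sum>k\<le>n. \<bar>norm (s k) / real k\<bar>) + (\<Sum>m\<le>n. norm (g m)))"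
      by simp
  qed
  ultimately have Xo: "X \<in> o(\<lambda>n. real n * P n)"
    by (rule landau_o.big_small_trans[rotated])
  \<comment> \<open>The terms of the Abel sum are \<open>o(P n / (n + 1))\<close>, which is
    \<open>o(p n)\<close> by \<open>P_le\<close>, so \<open>sum_smallo_P\<close> applies to
    them.\<close>
  have Xp: "(\<lambda>n. X n / (real n * real (Suc n))) \<in> o(p)"
  proof -
    have "eventually (\<lambda>n. real n * real (Suc n) \<noteq> 0) at_top"
      using pn by eventually_elim simp
    then have "(\<lambda>n. X n / (real n * real (Suc n))) \<in> o(\<lambda>n. (real n * P n) / (real n * real (Suc n)))"
      by (rule landau_o.small.divide_right) (rule Xo)
    also have "(\<lambda>n. (real n * P n) / (real n * real (Suc n))) \<in> O(p)"
    proof (rule bigoI[of _ "1 / c + 1"])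
      show "\<forall>\<^sub>F n in at_top. norm (real n * P n / (real n * real (Suc n))) \<le> (1 / c + 1) * norm (p n)"
        using pn
      proof eventually_elim
        case (elim n)
        have "P n / real (Suc n) \<le> (1 / c + 1) * p n"
          unfolding pos_divide_le_eq[OF of_nat_0_less_iff[THEN iffD2, OF zero_less_Suc]]
          using P_le[of n] by (simp only: mult_ac)
        moreover have "0 \<le> P n / real (Suc n)" using P_ge_1[of n] by simp
        ultimately show ?case using elim p_pos[of n] by simp
      qed
    qed
    finally show ?thesis .
  qed
  have X2: "(\<lambda>n. \<Sum>m\<le>n. \<bar>X m / (real m * real (Suc m))\<bar>) \<in> o(P)"
    by (rule sum_smallo_P[OF Xp])
  have X1: "(\<lambda>n. X n / real (Suc n)) \<in> o(P)"
  proof -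
    have "(\<lambda>n. X n / real (Suc n)) \<in> o(\<lambda>n. (real n * P n) / real (Suc n))"
      by (rule landau_o.small.divide_right[OF _ Xo]) auto
    also have "(\<lambda>n. (real n * P n) / real (Suc n)) \<in> O(P)"
    proof (rule bigoI[of _ 1], rule always_eventually, rule allI)
      fix n
      have "real n * P n \<le> real (Suc n) * P n" using P_ge_1[of n] by (intro mult_right_mono) auto
      then show "norm (real n * P n / real (Suc n)) \<le> 1 * norm (P n)"
        using P_ge_1[of n] by (simp add: abs_mult divide_le_eq mult.commute)
    qed
    finally show ?thesis .
  qed
  have X0: "(\<lambda>n. norm (b 0)) \<in> o(P)"
    by (intro smalloI_tendsto tendsto_divide_0[OF tendsto_const]
      filterlim_at_top_imp_at_infinity P_at_top always_eventually) (simp add: less_imp_neq[OF P_pos, symmetric])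
  have "Y \<in> o(P)"
  proof -
    have "(\<lambda>n. norm (b 0) + X n / real (Suc n) + (\<Sum>m\<le>n. \<bar>X m / (real m * real (Suc m))\<bar>)) \<in> o(P)"
      by (intro sum_in_smallo X0 X1 X2)
    also have "(\<lambda>n. norm (b 0) + X n / real (Suc n) + (\<Sum>m\<le>n. \<bar>X m / (real m * real (Suc m))\<bar>)) = Y"
    proof
      fix n
      have "0 \<le> X m" for m unfolding X_def by (intro sum_nonneg) auto
      then have "\<bar>X m / (real m * real (Suc m))\<bar> = X m / (real m * real (Suc m))" for m
        by (intro abs_of_nonneg divide_nonneg_nonneg) auto
      then show "norm (b 0) + X n / real (Suc n) + (\<Sum>m\<le>n. \<bar>X m / (real m * real (Suc m))\<bar>) = Y n"
        using sum_norm_b_eq[of n, folded X_def] by (simp only: Y_def)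
    qed
    finally show ?thesis .
  qed
  then have "Y \<in> o(\<lambda>n. real n * p n)" using P_bigo by (rule landau_o.small_big_trans)
  then have "(\<lambda>n. norm (s n) + C * Y n) \<in> o(\<lambda>n. real n * p n)"
    by (intro sum_in_smallo s landau_o.small.cmult_in_iff[THEN iffD2]) (use C_pos in auto)
  moreover have "(\<lambda>n. real n * norm (b n)) \<in> O(\<lambda>n. norm (s n) + C * Y n)"
  proof (rule bigoI[of _ 1], rule always_eventually, rule allI)
    fix n
    have "real n * norm (b n) = norm (of_nat n * b n)" by (simp add: norm_mult)
    also have "\<dots> \<le> norm (s n) + norm (g n)" unfolding n_b_eq by (rule norm_triangle_ineq)
    also have "norm (g n) \<le> C * Y n" unfolding Y_def by (rule norm_g_le)
    finally show "norm (real n * norm (b n)) \<le> 1 * norm (norm (s n) + C * Y n)" by simp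
  qed
  ultimately have "(\<lambda>n. real n * norm (b n)) \<in> o(\<lambda>n. real n * p n)"
    by (rule landau_o.big_small_trans[rotated])
  then show ?thesis
    using pn by (subst (asm) landau_o.small.mult_cancel_left) auto
qed

text \<open>In \<open>s n = n * b n - g n\<close>, the last term is at most \<open>C\<close> times a
  sum that is \<open>o(P)\<close>, hence \<open>o(n * p n)\<close> by \<open>P_bigo\<close>.\<close>

lemma s_smallo_if:
  assumes b: "(\<lambda>n. norm (b n)) \<in> o(p)"
  shows "(\<lambda>n. norm (s n)) \<in> o(\<lambda>n. real n * p n)"
proof -
  have "(\<lambda>n. \<Sum>m\<le>n. norm (b m)) \<in> o(\<lambda>n. real n * p n)"
    using landau_o.small_big_trans[OF sum_smallo_P[OF b] P_bigo] by simp
  moreover have "(\<lambda>n. real n * norm (b n)) \<in> o(\<lambda>n. real n * p n)"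
    by (rule landau_o.small.mult_left[OF b])
  ultimately have "(\<lambda>n. real n * norm (b n) + C * (\<Sum>m\<le>n. norm (b m))) \<in> o(\<lambda>n. real n * p n)"
    by (intro sum_in_smallo landau_o.small.cmult_in_iff[THEN iffD2]) (use C_pos in auto)
  moreover have "(\<lambda>n. norm (s n)) \<in> O(\<lambda>n. real n * norm (b n) + C * (\<Sum>m\<le>n. norm (b m)))"
  proof (rule bigoI[of _ 1], rule always_eventually, rule allI)
    fix n
    have "s n = of_nat n * b n - g n" by (simp add: n_b_eq)
    then have "norm (s n) \<le> norm (of_nat n * b n) + norm (g n)" using norm_triangle_ineq4 by metis
    also have "norm (of_nat n * b n) = real n * norm (b n)" by (simp add: norm_mult)
    also have "norm (g n) \<le> C * (\<Sum>m\<le>n. norm (b m))" by (rule norm_g_le)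
    finally show "norm (norm (s n)) \<le> 1 * norm (real n * norm (b n) + C * (\<Sum>m\<le>n. norm (b m)))" by simp
  qed
  ultimately show ?thesis by (rule landau_o.big_small_trans[rotated])
qed

text \<open>Abelian argument: the series of \<open>f * G\<close> is at most
  \<open>\<epsilon> / 2 * q x + K\<close>, and \<open>K\<close> is negligible because
  \<open>q\<close> tends to infinity. Division by \<open>q x = norm (G x)\<close> gives the
  claim.\<close>

lemma f_tendsto_0_if:
  assumes b: "(\<lambda>n. norm (b n)) \<in> o(p)"
  shows "((\<lambda>x::real. f (of_real x)) \<longlongrightarrow> 0) (at_left 1)"
proof (rule tendstoI)
  fix \<epsilon> :: real assume \<epsilon>: "\<epsilon> > 0"
  obtain N where N: "\<And>n. n \<ge> N \<Longrightarrow> norm (b n) \<le> \<epsilon> / 2 * p n"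
    using landau_o.smallD[OF b, of "\<epsilon> / 2"] \<epsilon> less_imp_le[OF p_pos]
    by (auto simp: eventually_sequentially)
  define K where "K = (\<Sum>k<N. norm (b k))"
  have "eventually (\<lambda>x. 2 * K / \<epsilon> < q x) (at_left 1)"
    using q_at_top by (simp add: filterlim_at_top_dense)
  moreover have "eventually (\<lambda>x::real. x \<in> {0<..<1}) (at_left 1)"
    by (rule eventually_at_left_real) simp
  ultimately show "eventually (\<lambda>x. dist (f (of_real x)) 0 < \<epsilon>) (at_left 1)"
  proof eventually_elim
    case (elim x)
    then have x: "0 \<le> x" "x < 1" by auto
    have "norm (f (of_real x) * G (of_real x)) \<le> \<epsilon> / 2 * q x + K"
    proof (rule norm_sums_le[OF disc_seriesD[OF disc_series_b]])
      show "(\<lambda>n. \<epsilon> / 2 * (p n * x ^ n) + (if n \<in> {..<N} then norm (b n) else 0)) sums (\<epsilon> / 2 * q x + K)"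
        unfolding K_def by (intro sums_add sums_mult sums_q x sums_If_finite_set) auto
      fix n
      show "norm (b n * of_real x ^ n) \<le> \<epsilon> / 2 * (p n * x ^ n) + (if n \<in> {..<N} then norm (b n) else 0)"
      proof (cases "n < N")
        case True
        have "norm (b n * of_real x ^ n) \<le> norm (b n) * 1"
          unfolding norm_mult norm_power by (intro mult_left_mono power_le_one) (use x in auto)
        moreover have "0 \<le> \<epsilon> / 2 * (p n * x ^ n)" using \<epsilon> p_pos[of n] x by simp
        ultimately show ?thesis using True by simp
      next
        case False
        then have "norm (b n) * x ^ n \<le> \<epsilon> / 2 * p n * x ^ n"
          using N[of n] x by (intro mult_right_mono) auto
        then show ?thesis using False x by (simp add: norm_mult norm_power mult_ac)
      qed
    qed (use x in auto)
    also have "K < \<epsilon> / 2 * q x" using elim \<epsilon> by (simp add: field_simps)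
    finally have "norm (f (of_real x)) * q x < \<epsilon> * q x"
      using q_pos[of x] by (simp add: norm_mult q_def[symmetric])
    then show ?case using q_pos[of x] by simp
  qed
qed

lemma b_smallo_iff:
  "(\<lambda>n. norm (b n)) \<in> o(p) \<longleftrightarrow>
   ((\<lambda>x::real. f (of_real x)) \<longlongrightarrow> 0) (at_left 1) \<and> (\<lambda>n. norm (s n)) \<in> o(\<lambda>n. real n * p n)"
  using b_smallo_if s_smallo_if f_tendsto_0_if by blast

end

theorem theorem10:
  fixes d :: "nat \<Rightarrow> real" and d_minus d_plus :: real
    and p :: "nat \<Rightarrow> real"
    and f :: "complex \<Rightarrow> complex" and a :: "nat \<Rightarrow> complex"
    and A :: complex
  assumes "0 < d_minus"
    and "\<And>j. j \<ge> 1 \<Longrightarrow> d_minus < d j \<and> d j < d_plus"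
    and "\<And>z::complex. norm z < 1 \<Longrightarrow>
           (\<lambda>n. of_real (p n) * z ^ n) sums
             exp (\<Sum>j. of_real (d (Suc j)) / of_nat (Suc j) * z ^ Suc j)"
    and "f analytic_on ball 0 1"
    and "\<And>z. norm z < 1 \<Longrightarrow> (\<lambda>n. a n * z ^ n) sums f z"
  shows "((\<lambda>n. 1 / of_real (p n) * (\<Sum>k=0..n. a k * of_real (p (n - k)))) \<longlonglongrightarrow> A)
     \<longleftrightarrow>
         ((\<lambda>x::real. f (of_real x)) \<longlongrightarrow> A) (at_left 1) \<and>
         (\<lambda>n. \<Sum>k=1..n. a k * of_nat k * of_real (p (n - k))) \<in> o(\<lambda>n. of_nat n * of_real (p n))"
proof -
  \<comment> \<open>Changing only the constant coefficient subtracts \<open>A * p n\<close> from the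
    convolution and leaves \<open>s\<close> unchanged, since there the index 0 carries the factor
    0.\<close>
  define a' where "a' n = a n - (if n = 0 then A else 0)" for n
  interpret weighted_series d d_minus d_plus p a' "\<lambda>z. f z - A"
  proof unfold_locales
    show "disc_series a' (\<lambda>z. f z - A)"
      unfolding disc_series_def
    proof (intro allI impI)
      fix z :: complex assume z: "norm z < 1"
      have "(\<lambda>n. (if n = 0 then A else 0) * z ^ n) sums (A * z ^ 0)"
        using sums_single[of 0 "\<lambda>n. A * z ^ n"] by (rule sums_cong[THEN iffD1, rotated]) simp
      from sums_diff[OF assms(5)[OF z] this] show "(\<lambda>n. a' n * z ^ n) sums (f z - A)"
        by (simp add: a'_def left_diff_distrib)
    qed
  qed (use assms in auto)
  have p0: "p n \<noteq> 0" for n using p_pos[of n] by simp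
  have b: "b n = (\<Sum>k=0..n. a k * of_real (p (n - k))) - A * of_real (p n)" for n
  proof -
    have "b n = (\<Sum>k\<le>n. a k * of_real (p (n - k))) - (\<Sum>k\<le>n. if k = 0 then A * of_real (p (n - k)) else 0)"
      unfolding b_def sum_subtractf[symmetric] by (intro sum.cong) (auto simp: a'_def left_diff_distrib)
    then show ?thesis by (simp add: atMost_atLeast0)
  qed
  have s: "s n = (\<Sum>k=1..n. a k * of_nat k * of_real (p (n - k)))" for n
    unfolding s_def by (rule sum.mono_neutral_cong_right) (auto simp: a'_def)
  have "((\<lambda>n. 1 / of_real (p n) * (\<Sum>k=0..n. a k * of_real (p (n - k)))) \<longlonglongrightarrow> A)
      \<longleftrightarrow> ((\<lambda>n. b n / of_real (p n)) \<longlonglongrightarrow> 0)"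
    \<comment> \<open>Subtracting \<open>A\<close> from the quotient gives exactly
      \<open>b n / p n\<close>, because \<open>p n\<close> is nonzero.\<close>
    by (subst LIM_zero_iff[symmetric]) (simp add: b diff_divide_distrib p0)
  also have "\<dots> \<longleftrightarrow> b \<in> o(\<lambda>n. complex_of_real (p n))"
    using smalloD_tendsto[of b _ "\<lambda>n. complex_of_real (p n)"]
      smalloI_tendsto[of b "\<lambda>n. complex_of_real (p n)"] p0 by auto
  also have "\<dots> \<longleftrightarrow> (\<lambda>n. norm (b n)) \<in> o(p)"
    by (simp add: smallo_def)
  also note b_smallo_iff
  also have "(\<lambda>n. norm (s n)) \<in> o(\<lambda>n. real n * p n) \<longleftrightarrow> s \<in> o(\<lambda>n. of_nat n * complex_of_real (p n))"
    by (simp add: smallo_def norm_mult abs_mult)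
  also have "((\<lambda>x::real. f (of_real x) - A) \<longlongrightarrow> 0) (at_left 1) \<longleftrightarrow> ((\<lambda>x::real. f (of_real x)) \<longlongrightarrow> A) (at_left 1)"
    by (rule LIM_zero_iff)
  also have "s = (\<lambda>n. \<Sum>k=1..n. a k * of_nat k * of_real (p (n - k)))"
    using s by (rule ext)
  finally show ?thesis .
qed

end
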